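(* Let $G$ be a Poisson–Lie group whose Lie bialgebra $\mathfrak g$ is quasitriangular. A left-invariant preconnection $\tilde\gamma$ on $G$ given by $\hat\Xi$ is bicovariant if and only if $\hat\Xi$ is $\mathrm{Ad}$-invariant, i.e. $\hat\Xi(\phi,\psi)=\mathrm{Ad}^*_{g^{-1}}\hat\Xi(\mathrm{Ad}^*_g\phi,\mathrm{Ad}^*_g\psi)$ for all $g\in G$ and $\phi,\psi\in\mathfrak g^*$. The infinitesimal form of this invariance condition, with $\hat\Xi$ viewed as a map $\mathfrak g\to\mathfrak g\otimes\mathfrak g$, $\hat\Xi(v)=\hat\Xi^{[1]}(v)\otimes\hat\Xi^{[2]}(v)$, is $$\hat\Xi([v,w])=[\hat\Xi^{[1]}(v),w]\otimes\hat\Xi^{[2]}(v)+\hat\Xi^{[1]}(v)\otimes[\hat\Xi^{[2]}(v),w]\qquad\forall v,w\in\mathfrak g.$$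
   Context: $G$ is a Poisson–Lie group with Lie algebra $\mathfrak g=T_eG$; $gv$, $vg$ denote the images of $v\in\mathfrak g$ in $T_gG$ under left and right translation. The Poisson bivector is $\omega=\omega^{[1]}\otimes\omega^{[2]}$ (summation understood), $\{a,b\}(g)=a'(g;\omega^{[1]}(g))\,b'(g;\omega^{[2]}(g))$, where $a'(g;u)$ is the derivative of $a$ at $g$ in direction $u\in T_gG$ (also for vector-valued functions). Quasitriangular: $\delta v=\mathrm{ad}_v(r)$ with $r\in\mathfrak g\otimes\mathfrak g$ satisfying $[r_{12},r_{13}]+[r_{12},r_{23}]+[r_{13},r_{23}]=0$ and $r_+=\frac12(r+r_{21})$ ad-invariant; then $\omega(g)=gr-rg=gr_--r_-g$, where $r_-=\frac12(r-r_{21})=r_-^{[1]}\otimes r_-^{[2]}$. Conventions: $\mathrm{Ad}^*_g=(\mathrm{Ad}_{g^{-1}})^*$ and $(\mathrm{ad}^*_v\psi)(w)=\psi([w,v])$. A preconnection is a map $\gamma:C^\infty(G)\times\Omega^1(G)\to\Omega^1(G)$ with $\gamma(xy,\tau)=x\gamma(y,\tau)+\gamma(x,\tau)y$ and $\gamma(x,\tau y)=\gamma(x,\tau)y+\tau\{x,y\}$. A $1$-form $\tau$ is identified with $\tilde\tau\in C^\infty(G,\mathfrak g^* )$, $\tilde\tau(g)(v)=\tau(g)(gv)$, and $\tilde\gamma(a,\tilde\tau)=\widetilde{\gamma(a,\tau)}$. It is left invariant when $\tilde\gamma(a,s)(g)=\{a,s\}(g)+\Xi(\hat L_a(g),s(g))$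 for a bilinear map $\Xi:\mathfrak g^*\otimes\mathfrak g^*\to\mathfrak g^*$ independent of $g$, where $\hat L_a(g)(v)=a'(g;gv)$. Similarly it is right invariant when, for the right trivialisation $t(g)=\mathrm{Ad}^*_gs(g)$ and $\hat R_a(g)(v)=a'(g;vg)$, one has $\mathrm{Ad}^*_g(\tilde\gamma(a,s)(g))=\{a,t\}(g)+\Psi(\hat R_a(g),t(g))$ for a bilinear $\Psi:\mathfrak g^*\otimes\mathfrak g^*\to\mathfrak g^*$ independent of $g$. It is bicovariant if it is both left and right invariant. The left-invariant preconnection given by $\hat\Xi$ is the one for which $\Xi(\phi,\psi)=\hat\Xi(\phi,\psi)+\phi(r_-^{[1]})\,\mathrm{ad}^*_{r_-^{[2]}}\psi$. The bilinear map $\hat\Xi$ is also viewed as a linear map $\mathfrak g\to\mathfrak g\otimes\mathfrak g$ by $\hat\Xi(\phi,\psi)(v)=(\phi\otimes\psi)(\hat\Xi(v))$. *)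

theory Defs
  imports "HOL-Analysis.Analysis" "HOL-Algebra.Group"
begin

section \<open>Smooth maps between open sets of vector spaces\<close>

text \<open>
  On an open set this is the usual notion of class \<open>C\<^sup>k\<close>; the derivatives of order up to
  \<open>k\<close> are tested direction by direction, which suffices because the domain is
  finite-dimensional.
\<close>

fun Ck_on :: "nat \<Rightarrow> 'a::euclidean_space set \<Rightarrow> ('a \<Rightarrow> 'b::real_normed_vector) \<Rightarrow> bool" where
  "Ck_on 0 S f \<longleftrightarrow> continuous_on S f"
| "Ck_on (Suc k) S f \<longleftrightarrow>
     (\<forall>x\<in>S. f differentiable (at x)) \<and> (\<forall>v. Ck_on k S (\<lambda>x. frechet_derivative f (at x) v))"

definition smooth_on :: "'a::euclidean_space set \<Rightarrow> ('a \<Rightarrow> 'b::real_normed_vector) \<Rightarrow> bool" where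
  "smooth_on S f \<longleftrightarrow> open S \<and> (\<forall>k. Ck_on k S f)"


section \<open>Tensors\<close>

text \<open>
  For a finite-dimensional \<open>V\<close>, the space \<open>V \<otimes> V\<close> is taken to be the space of bilinear forms
  on the dual of \<open>V\<close>: the value \<open>t \<phi> \<psi>\<close> is \<open>(\<phi> \<otimes> \<psi>)(t)\<close>. Similarly for \<open>V \<otimes> V \<otimes> V\<close>.
\<close>

type_synonym 'e covec = "'e \<Rightarrow>\<^sub>L real"
type_synonym 'e tens2 = "'e covec \<Rightarrow>\<^sub>L 'e covec \<Rightarrow>\<^sub>L real"
type_synonym 'e tens3 = "'e covec \<Rightarrow>\<^sub>L 'e tens2"

definition tensor :: "'e::euclidean_space \<Rightarrow> 'e \<Rightarrow> 'e tens2" where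
  "tensor x y = Blinfun (\<lambda>\<phi> :: 'e covec. \<phi> x *\<^sub>R Blinfun (\<lambda>\<psi> :: 'e covec. \<psi> y))"

definition tensor3 :: "'e::euclidean_space \<Rightarrow> 'e \<Rightarrow> 'e \<Rightarrow> 'e tens3" where
  "tensor3 x y z = Blinfun (\<lambda>\<phi> :: 'e covec. \<phi> x *\<^sub>R tensor y z)"

text \<open>
  \<open>contract f t\<close> is what the summation convention writes as \<open>f(t\<^sup>1, t\<^sup>2)\<close> for
  \<open>t = t\<^sup>1 \<otimes> t\<^sup>2\<close> and bilinear \<open>f\<close>; the inner product only serves to write down a dual
  basis, and the result is independent of it (see \<open>contract_tensor\<close> below).
\<close>

definition contract :: "('e::euclidean_space \<Rightarrow> 'e \<Rightarrow> 'b::real_vector) \<Rightarrow> 'e tens2 \<Rightarrow> 'b" where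
  "contract f t =
     (\<Sum>i\<in>Basis. \<Sum>j\<in>Basis. t (blinfun_inner_left i) (blinfun_inner_left j) *\<^sub>R f i j)"

lemma tensor_apply: "tensor x y \<phi> \<psi> = \<phi> x * \<psi> y"
proof -
  have "bounded_linear (\<lambda>\<psi> :: 'a covec. \<psi> y)"
    by (rule blinfun.bounded_linear_left)
  moreover have "bounded_linear (\<lambda>\<phi> :: 'a covec. \<phi> x *\<^sub>R (Blinfun (\<lambda>\<psi> :: 'a covec. \<psi> y)))"
    by (rule bounded_linear_scaleR_const)
      (rule blinfun.bounded_linear_left)
  ultimately show ?thesis
    by (simp add: tensor_def bounded_linear_Blinfun_apply blinfun.scaleR_left)
qed

lemma tensor3_apply: "tensor3 x y z \<phi> = \<phi> x *\<^sub>R tensor y z"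
proof -
  have "bounded_linear (\<lambda>\<phi> :: 'a covec. \<phi> x *\<^sub>R tensor y z)"
    by (rule bounded_linear_scaleR_const)
      (rule blinfun.bounded_linear_left)
  then show ?thesis
    by (simp add: tensor3_def bounded_linear_Blinfun_apply)
qed

lemma contract_tensor:
  assumes "bilinear f"
  shows "contract f (tensor x y) = f x y"
proof -
  have l: "linear (f u)" and r: "linear (\<lambda>u. f u v)" for u v
    using assms by (auto simp: bilinear_def)
  have "f x y = f (\<Sum>i\<in>Basis. (x \<bullet> i) *\<^sub>R i) y"
    by (simp add: euclidean_representation)
  also have "\<dots> = (\<Sum>i\<in>Basis. (x \<bullet> i) *\<^sub>R f i y)"
    by (simp add: linear_sum[OF r] linear_scale[OF r])
  also have "\<dots> = (\<Sum>i\<in>Basis. (x \<bullet> i) *\<^sub>R f i (\<Sum>j\<in>Basis. (y \<bullet> j) *\<^sub>R j))"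
    by (simp add: euclidean_representation)
  also have "\<dots> = (\<Sum>i\<in>Basis. \<Sum>j\<in>Basis. ((x \<bullet> i) * (y \<bullet> j)) *\<^sub>R f i j)"
    by (simp add: linear_sum[OF l] linear_scale[OF l] scaleR_sum_right)
  finally show ?thesis
    by (simp add: contract_def tensor_apply)
qed

definition flip :: "'e::euclidean_space tens2 \<Rightarrow> 'e tens2" where
  "flip t = contract (\<lambda>x y. tensor y x) t"

definition sym_part :: "'e::euclidean_space tens2 \<Rightarrow> 'e tens2" where
  "sym_part r = (1/2) *\<^sub>R (r + flip r)"

definition skew_part :: "'e::euclidean_space tens2 \<Rightarrow> 'e tens2" where
  "skew_part r = (1/2) *\<^sub>R (r - flip r)"


section \<open>Lie groups\<close>

text \<open>
  A group together with an atlas indexed by the points of the group, the chart indexed by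
  \<open>p\<close> being a chart around \<open>p\<close>. The tangent space at \<open>p\<close> is identified with the model space
  \<open>'e\<close> by means of that chart. In particular \<open>'e\<close>, viewed as the tangent space at the identity,
  is the underlying vector space of the Lie algebra, and \<open>'e covec\<close> is its dual.
\<close>

record ('g, 'e) lie_struct = "'g monoid" +
  chart_dom :: "'g \<Rightarrow> 'g set"
  chart :: "'g \<Rightarrow> 'g \<Rightarrow> 'e"

definition chart_img :: "('g, 'e) lie_struct \<Rightarrow> 'g \<Rightarrow> 'e set" where
  "chart_img G p = chart G p ` chart_dom G p"

definition chart_inv :: "('g, 'e) lie_struct \<Rightarrow> 'g \<Rightarrow> 'e \<Rightarrow> 'g" where
  "chart_inv G p = inv_into (chart_dom G p) (chart G p)"

definition smooth_manifold ::
  "('g::{t2_space,second_countable_topology}, 'e::euclidean_space) lie_struct \<Rightarrow> bool" where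
  "smooth_manifold G \<longleftrightarrow>
     (\<forall>p. p \<in> chart_dom G p \<and> open (chart_dom G p) \<and> open (chart_img G p) \<and>
          homeomorphism (chart_dom G p) (chart_img G p) (chart G p) (chart_inv G p)) \<and>
     (\<forall>p q. smooth_on (chart G p ` (chart_dom G p \<inter> chart_dom G q)) (chart G q \<circ> chart_inv G p))"

definition lie_group ::
  "('g::{t2_space,second_countable_topology}, 'e::euclidean_space) lie_struct \<Rightarrow> bool" where
  "lie_group G \<longleftrightarrow>
     group G \<and> carrier G = UNIV \<and> smooth_manifold G \<and>
     continuous_on UNIV (\<lambda>(g, h). g \<otimes>\<^bsub>G\<^esub> h) \<and>
     (\<forall>p q k. smooth_on
        {(x, y). x \<in> chart_img G p \<and> y \<in> chart_img G q \<and>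
                 chart_inv G p x \<otimes>\<^bsub>G\<^esub> chart_inv G q y \<in> chart_dom G k}
        (\<lambda>(x, y). chart G k (chart_inv G p x \<otimes>\<^bsub>G\<^esub> chart_inv G q y))) \<and>
     continuous_on UNIV (\<lambda>g. inv\<^bsub>G\<^esub> g) \<and>
     (\<forall>p k. smooth_on
        {x \<in> chart_img G p. inv\<^bsub>G\<^esub> (chart_inv G p x) \<in> chart_dom G k}
        (\<lambda>x. chart G k (inv\<^bsub>G\<^esub> (chart_inv G p x))))"

definition smooth_fun ::
  "('g, 'e::euclidean_space) lie_struct \<Rightarrow> ('g \<Rightarrow> 'b::real_normed_vector) \<Rightarrow> bool" where
  "smooth_fun G f \<longleftrightarrow> (\<forall>p. smooth_on (chart_img G p) (f \<circ> chart_inv G p))"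

text \<open>\<open>mderiv G f p u\<close> is \<open>f'(p; u)\<close> for a vector-valued function \<open>f\<close> and \<open>u\<close> tangent at \<open>p\<close>.\<close>

definition mderiv ::
  "('g, 'e::euclidean_space) lie_struct \<Rightarrow> ('g \<Rightarrow> 'b::real_normed_vector) \<Rightarrow> 'g \<Rightarrow> 'e \<Rightarrow> 'b" where
  "mderiv G f p u = frechet_derivative (f \<circ> chart_inv G p) (at (chart G p p)) u"

text \<open>The tangent map at \<open>p\<close> of a self-map \<open>F\<close> of the group, from the tangent space at \<open>p\<close> to
  that at \<open>F p\<close>.\<close>

definition tmap ::
  "('g, 'e::euclidean_space) lie_struct \<Rightarrow> ('g \<Rightarrow> 'g) \<Rightarrow> 'g \<Rightarrow> 'e \<Rightarrow> 'e" where
  "tmap G F p u = frechet_derivative (chart G (F p) \<circ> F \<circ> chart_inv G p) (at (chart G p p)) u"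

definition push ::
  "('g, 'e::euclidean_space) lie_struct \<Rightarrow> ('g \<Rightarrow> 'g) \<Rightarrow> 'g \<Rightarrow> 'e tens2 \<Rightarrow> 'e tens2" where
  "push G F p t = contract (\<lambda>u v. tensor (tmap G F p u) (tmap G F p v)) t"

text \<open>\<open>coord_change G a b q\<close> converts the components at \<open>q\<close> of a tangent vector with respect to
  the chart indexed by \<open>a\<close> into those with respect to the chart indexed by \<open>b\<close>.\<close>

definition coord_change ::
  "('g, 'e::euclidean_space) lie_struct \<Rightarrow> 'g \<Rightarrow> 'g \<Rightarrow> 'g \<Rightarrow> 'e \<Rightarrow> 'e" where
  "coord_change G a b q u = frechet_derivative (chart G b \<circ> chart_inv G a) (at (chart G a q)) u"

text \<open>The images \<open>gv\<close> and \<open>vg\<close> of a Lie algebra element under translation.\<close>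

definition ltrans :: "('g, 'e::euclidean_space) lie_struct \<Rightarrow> 'g \<Rightarrow> 'e \<Rightarrow> 'e" where
  "ltrans G g v = tmap G (\<lambda>h. g \<otimes>\<^bsub>G\<^esub> h) \<one>\<^bsub>G\<^esub> v"

definition rtrans :: "('g, 'e::euclidean_space) lie_struct \<Rightarrow> 'g \<Rightarrow> 'e \<Rightarrow> 'e" where
  "rtrans G g v = tmap G (\<lambda>h. h \<otimes>\<^bsub>G\<^esub> g) \<one>\<^bsub>G\<^esub> v"

definition vf_bracket ::
  "('g, 'e::euclidean_space) lie_struct \<Rightarrow> ('g \<Rightarrow> 'e) \<Rightarrow> ('g \<Rightarrow> 'e) \<Rightarrow> 'g \<Rightarrow> 'e" where
  "vf_bracket G X Y p =
     mderiv G (\<lambda>q. coord_change G q p q (Y q)) p (X p) -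
     mderiv G (\<lambda>q. coord_change G q p q (X q)) p (Y p)"

definition lie_bracket :: "('g, 'e::euclidean_space) lie_struct \<Rightarrow> 'e \<Rightarrow> 'e \<Rightarrow> 'e" where
  "lie_bracket G v w = vf_bracket G (\<lambda>g. ltrans G g v) (\<lambda>g. ltrans G g w) \<one>\<^bsub>G\<^esub>"

definition Ad :: "('g, 'e::euclidean_space) lie_struct \<Rightarrow> 'g \<Rightarrow> 'e \<Rightarrow> 'e" where
  "Ad G g v = tmap G (\<lambda>h. g \<otimes>\<^bsub>G\<^esub> h \<otimes>\<^bsub>G\<^esub> inv\<^bsub>G\<^esub> g) \<one>\<^bsub>G\<^esub> v"

definition Ad_star :: "('g, 'e::euclidean_space) lie_struct \<Rightarrow> 'g \<Rightarrow> 'e covec \<Rightarrow> 'e covec" where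
  "Ad_star G g \<phi> = Blinfun (\<lambda>v. \<phi> (Ad G (inv\<^bsub>G\<^esub> g) v))"

text \<open>The sign convention is \<open>(ad\<^sup>* v \<psi>)(w) = \<psi>([w, v])\<close>.\<close>

definition ad_star :: "('g, 'e::euclidean_space) lie_struct \<Rightarrow> 'e \<Rightarrow> 'e covec \<Rightarrow> 'e covec" where
  "ad_star G v \<psi> = Blinfun (\<lambda>w. \<psi> (lie_bracket G w v))"

definition ad_tens :: "('g, 'e::euclidean_space) lie_struct \<Rightarrow> 'e \<Rightarrow> 'e tens2 \<Rightarrow> 'e tens2" where
  "ad_tens G v t =
     contract (\<lambda>x y. tensor (lie_bracket G v x) y + tensor x (lie_bracket G v y)) t"


section \<open>Poisson--Lie groups\<close>

definition smooth_bivector ::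
  "('g, 'e::euclidean_space) lie_struct \<Rightarrow> ('g \<Rightarrow> 'e tens2) \<Rightarrow> bool" where
  "smooth_bivector G \<omega> \<longleftrightarrow>
     (\<forall>p. smooth_on (chart_img G p)
        ((\<lambda>q. contract (\<lambda>u v. tensor (coord_change G q p q u) (coord_change G q p q v)) (\<omega> q))
           \<circ> chart_inv G p)) \<and>
     (\<forall>q \<phi> \<psi>. \<omega> q \<phi> \<psi> = - \<omega> q \<psi> \<phi>)"

text \<open>The bracket \<open>{a, s}\<close>, where \<open>s\<close> may be vector-valued.\<close>

definition pbracket ::
  "('g, 'e::euclidean_space) lie_struct \<Rightarrow> ('g \<Rightarrow> 'e tens2) \<Rightarrow>
     ('g \<Rightarrow> real) \<Rightarrow> ('g \<Rightarrow> 'b::real_normed_vector) \<Rightarrow> 'g \<Rightarrow> 'b" where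
  "pbracket G \<omega> a s g = contract (\<lambda>u v. mderiv G a g u *\<^sub>R mderiv G s g v) (\<omega> g)"

definition poisson_bivector ::
  "('g, 'e::euclidean_space) lie_struct \<Rightarrow> ('g \<Rightarrow> 'e tens2) \<Rightarrow> bool" where
  "poisson_bivector G \<omega> \<longleftrightarrow>
     smooth_bivector G \<omega> \<and>
     (\<forall>(a :: 'g \<Rightarrow> real) (b :: 'g \<Rightarrow> real) (c :: 'g \<Rightarrow> real) g.
        smooth_fun G a \<longrightarrow> smooth_fun G b \<longrightarrow> smooth_fun G c \<longrightarrow>
        pbracket G \<omega> a (pbracket G \<omega> b c) g + pbracket G \<omega> b (pbracket G \<omega> c a) g +
        pbracket G \<omega> c (pbracket G \<omega> a b) g = 0)"

definition poisson_lie_group ::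
  "('g::{t2_space,second_countable_topology}, 'e::euclidean_space) lie_struct \<Rightarrow>
     ('g \<Rightarrow> 'e tens2) \<Rightarrow> bool" where
  "poisson_lie_group G \<omega> \<longleftrightarrow>
     lie_group G \<and> poisson_bivector G \<omega> \<and>
     (\<forall>g h. \<omega> (g \<otimes>\<^bsub>G\<^esub> h) =
        push G (\<lambda>x. g \<otimes>\<^bsub>G\<^esub> x) h (\<omega> h) + push G (\<lambda>x. x \<otimes>\<^bsub>G\<^esub> h) g (\<omega> g))"

text \<open>The Lie cobracket \<open>\<delta>\<close> of the Lie bialgebra of a Poisson--Lie group is the derivative at the
  identity of the right-trivialised bivector \<open>g \<mapsto> \<omega>(g)g\<^sup>-\<^sup>1\<close>.\<close>

definition cobracket ::
  "('g, 'e::euclidean_space) lie_struct \<Rightarrow> ('g \<Rightarrow> 'e tens2) \<Rightarrow> 'e \<Rightarrow> 'e tens2" where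
  "cobracket G \<omega> v =
     mderiv G (\<lambda>g. push G (\<lambda>x. x \<otimes>\<^bsub>G\<^esub> inv\<^bsub>G\<^esub> g) g (\<omega> g)) \<one>\<^bsub>G\<^esub> v"

text \<open>The three summands are \<open>[r\<^sub>1\<^sub>2, r\<^sub>1\<^sub>3]\<close>, \<open>[r\<^sub>1\<^sub>2, r\<^sub>2\<^sub>3]\<close> and \<open>[r\<^sub>1\<^sub>3, r\<^sub>2\<^sub>3]\<close>, with
  \<open>a \<otimes> b\<close> and \<open>c \<otimes> d\<close> standing for the first and second copy of \<open>r\<close>.\<close>

definition classical_yang_baxter ::
  "('g, 'e::euclidean_space) lie_struct \<Rightarrow> 'e tens2 \<Rightarrow> bool" where
  "classical_yang_baxter G r \<longleftrightarrow>
     contract (\<lambda>a b. contract (\<lambda>c d. tensor3 (lie_bracket G a c) b d) r) r +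
     contract (\<lambda>a b. contract (\<lambda>c d. tensor3 a (lie_bracket G b c) d) r) r +
     contract (\<lambda>a b. contract (\<lambda>c d. tensor3 a c (lie_bracket G b d)) r) r = 0"

definition quasitriangular ::
  "('g, 'e::euclidean_space) lie_struct \<Rightarrow> ('g \<Rightarrow> 'e tens2) \<Rightarrow> 'e tens2 \<Rightarrow> bool" where
  "quasitriangular G \<omega> r \<longleftrightarrow>
     (\<forall>v. cobracket G \<omega> v = ad_tens G v r) \<and>
     classical_yang_baxter G r \<and>
     (\<forall>v. ad_tens G v (sym_part r) = 0)"

text \<open>
  The bivector \<open>g \<mapsto> gr - rg\<close>. If \<open>G\<close> is connected, then the bivector of a Poisson--Lie group
  with quasitriangular Lie bialgebra is necessarily of this form, because a multiplicative
  bivector is determined by its cobracket. On a disconnected group the Lie bialgebra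
  determines the bivector only on the identity component.
\<close>

definition coboundary_bivector ::
  "('g, 'e::euclidean_space) lie_struct \<Rightarrow> 'e tens2 \<Rightarrow> 'g \<Rightarrow> 'e tens2" where
  "coboundary_bivector G r g =
     contract (\<lambda>x y. tensor (ltrans G g x) (ltrans G g y)) r -
     contract (\<lambda>x y. tensor (rtrans G g x) (rtrans G g y)) r"


section \<open>Preconnections\<close>

text \<open>A 1-form assigns to \<open>q\<close> a functional on the tangent space at \<open>q\<close>; smoothness is smoothness
  of its components in every chart.\<close>

definition one_form ::
  "('g, 'e::euclidean_space) lie_struct \<Rightarrow> ('g \<Rightarrow> 'e covec) \<Rightarrow> bool" where
  "one_form G \<tau> \<longleftrightarrow>
     (\<forall>p. smooth_on (chart_img G p)
        ((\<lambda>q. Blinfun (\<lambda>v. \<tau> q (coord_change G p q q v))) \<circ> chart_inv G p))"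

definition preconnection ::
  "('g, 'e::euclidean_space) lie_struct \<Rightarrow> ('g \<Rightarrow> 'e tens2) \<Rightarrow>
     (('g \<Rightarrow> real) \<Rightarrow> ('g \<Rightarrow> 'e covec) \<Rightarrow> ('g \<Rightarrow> 'e covec)) \<Rightarrow> bool" where
  "preconnection G \<omega> \<gamma> \<longleftrightarrow>
     (\<forall>x \<tau>. smooth_fun G x \<longrightarrow> one_form G \<tau> \<longrightarrow> one_form G (\<gamma> x \<tau>)) \<and>
     (\<forall>x y \<tau>. smooth_fun G x \<longrightarrow> smooth_fun G y \<longrightarrow> one_form G \<tau> \<longrightarrow>
        \<gamma> (\<lambda>g. x g * y g) \<tau> = (\<lambda>g. x g *\<^sub>R \<gamma> y \<tau> g + y g *\<^sub>R \<gamma> x \<tau> g)) \<and>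
     (\<forall>x y \<tau>. smooth_fun G x \<longrightarrow> smooth_fun G y \<longrightarrow> one_form G \<tau> \<longrightarrow>
        \<gamma> x (\<lambda>g. y g *\<^sub>R \<tau> g) = (\<lambda>g. y g *\<^sub>R \<gamma> x \<tau> g + pbracket G \<omega> x y g *\<^sub>R \<tau> g))"

text \<open>The left trivialisation of a 1-form, a function with values in the dual of the Lie algebra.\<close>

definition ltriv ::
  "('g, 'e::euclidean_space) lie_struct \<Rightarrow> ('g \<Rightarrow> 'e covec) \<Rightarrow> 'g \<Rightarrow> 'e covec" where
  "ltriv G \<tau> g = Blinfun (\<lambda>v. \<tau> g (ltrans G g v))"

definition rtriv ::
  "('g, 'e::euclidean_space) lie_struct \<Rightarrow> ('g \<Rightarrow> 'e covec) \<Rightarrow> 'g \<Rightarrow> 'e covec" where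
  "rtriv G \<tau> g = Ad_star G g (ltriv G \<tau> g)"

definition L_hat ::
  "('g, 'e::euclidean_space) lie_struct \<Rightarrow> ('g \<Rightarrow> real) \<Rightarrow> 'g \<Rightarrow> 'e covec" where
  "L_hat G a g = Blinfun (\<lambda>v. mderiv G a g (ltrans G g v))"

definition R_hat ::
  "('g, 'e::euclidean_space) lie_struct \<Rightarrow> ('g \<Rightarrow> real) \<Rightarrow> 'g \<Rightarrow> 'e covec" where
  "R_hat G a g = Blinfun (\<lambda>v. mderiv G a g (rtrans G g v))"

definition left_invariant_via ::
  "('g, 'e::euclidean_space) lie_struct \<Rightarrow> ('g \<Rightarrow> 'e tens2) \<Rightarrow>
     (('g \<Rightarrow> real) \<Rightarrow> ('g \<Rightarrow> 'e covec) \<Rightarrow> ('g \<Rightarrow> 'e covec)) \<Rightarrow>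
     ('e covec \<Rightarrow> 'e covec \<Rightarrow> 'e covec) \<Rightarrow> bool" where
  "left_invariant_via G \<omega> \<gamma> \<Xi> \<longleftrightarrow>
     bilinear \<Xi> \<and>
     (\<forall>a \<tau> g. smooth_fun G a \<longrightarrow> one_form G \<tau> \<longrightarrow>
        ltriv G (\<gamma> a \<tau>) g = pbracket G \<omega> a (ltriv G \<tau>) g + \<Xi> (L_hat G a g) (ltriv G \<tau> g))"

definition right_invariant_via ::
  "('g, 'e::euclidean_space) lie_struct \<Rightarrow> ('g \<Rightarrow> 'e tens2) \<Rightarrow>
     (('g \<Rightarrow> real) \<Rightarrow> ('g \<Rightarrow> 'e covec) \<Rightarrow> ('g \<Rightarrow> 'e covec)) \<Rightarrow>
     ('e covec \<Rightarrow> 'e covec \<Rightarrow> 'e covec) \<Rightarrow> bool" where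
  "right_invariant_via G \<omega> \<gamma> \<Psi> \<longleftrightarrow>
     bilinear \<Psi> \<and>
     (\<forall>a \<tau> g. smooth_fun G a \<longrightarrow> one_form G \<tau> \<longrightarrow>
        Ad_star G g (ltriv G (\<gamma> a \<tau>) g) =
          pbracket G \<omega> a (rtriv G \<tau>) g + \<Psi> (R_hat G a g) (rtriv G \<tau> g))"

definition bicovariant ::
  "('g, 'e::euclidean_space) lie_struct \<Rightarrow> ('g \<Rightarrow> 'e tens2) \<Rightarrow>
     (('g \<Rightarrow> real) \<Rightarrow> ('g \<Rightarrow> 'e covec) \<Rightarrow> ('g \<Rightarrow> 'e covec)) \<Rightarrow> bool" where
  "bicovariant G \<omega> \<gamma> \<longleftrightarrow>
     (\<exists>\<Xi>. left_invariant_via G \<omega> \<gamma> \<Xi>) \<and> (\<exists>\<Psi>. right_invariant_via G \<omega> \<gamma> \<Psi>)"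

definition given_by ::
  "('g, 'e::euclidean_space) lie_struct \<Rightarrow> ('g \<Rightarrow> 'e tens2) \<Rightarrow> 'e tens2 \<Rightarrow>
     (('g \<Rightarrow> real) \<Rightarrow> ('g \<Rightarrow> 'e covec) \<Rightarrow> ('g \<Rightarrow> 'e covec)) \<Rightarrow>
     ('e covec \<Rightarrow> 'e covec \<Rightarrow> 'e covec) \<Rightarrow> bool" where
  "given_by G \<omega> r \<gamma> \<Xi>h \<longleftrightarrow>
     bilinear \<Xi>h \<and>
     left_invariant_via G \<omega> \<gamma>
       (\<lambda>\<phi> \<psi>. \<Xi>h \<phi> \<psi> + contract (\<lambda>x y. \<phi> x *\<^sub>R ad_star G y \<psi>) (skew_part r))"

text \<open>The right-hand side of the invariance condition.\<close>

definition Ad_transform ::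
  "('g, 'e::euclidean_space) lie_struct \<Rightarrow> ('e covec \<Rightarrow> 'e covec \<Rightarrow> 'e covec) \<Rightarrow>
     'g \<Rightarrow> 'e covec \<Rightarrow> 'e covec \<Rightarrow> 'e covec" where
  "Ad_transform G \<Xi>h g \<phi> \<psi> = Ad_star G (inv\<^bsub>G\<^esub> g) (\<Xi>h (Ad_star G g \<phi>) (Ad_star G g \<psi>))"

text \<open>A bilinear map \<open>\<Xi>h\<close> viewed as a map from the Lie algebra to its tensor square, so that
  \<open>(\<phi> \<otimes> \<psi>)(\<Xi>h v) = \<Xi>h(\<phi>, \<psi>)(v)\<close>.\<close>

definition as_tensor_map ::
  "('e::euclidean_space covec \<Rightarrow> 'e covec \<Rightarrow> 'e covec) \<Rightarrow> 'e \<Rightarrow> 'e tens2" where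
  "as_tensor_map \<Xi>h v = Blinfun (\<lambda>\<phi>. Blinfun (\<lambda>\<psi>. \<Xi>h \<phi> \<psi> v))"

end

theory Submission
  imports Defs
begin

text \<open>
  Write \<open>s\<close> and \<open>t = Ad\<^sup>* s\<close> for the left and right trivialisations of a 1-form, and
  \<open>K(\<phi>, \<psi>) = \<phi>(r\<^sub>-\<^sup>1) ad\<^sup>*(r\<^sub>-\<^sup>2) \<psi>\<close> for the term that separates \<open>\<Xi>\<close> from \<open>\<Xi>h\<close>. The bivector is
  \<open>\<omega>(g) = g r\<^sub>- - r\<^sub>- g\<close>. Differentiating \<open>t = Ad\<^sup>* s\<close> along \<open>g v\<close> gives \<open>Ad\<^sup>* (s' + ad\<^sup>*(v) s)\<close>, so
  \<open>{a, t}\<close> and \<open>Ad\<^sup>* {a, s}\<close> differ by a sum of two terms, one for each part of \<open>\<omega>\<close>: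
  the part \<open>g r\<^sub>-\<close> contributes \<open>Ad\<^sup>* K(L, s)\<close> and the part \<open>r\<^sub>- g\<close> contributes \<open>- K(R, t)\<close>, where
  \<open>L\<close> and \<open>R = Ad\<^sup>* L\<close> are the two trivialisations of the differential of \<open>a\<close>
  (\<open>pbracket_rtriv\<close>). The first one is exactly the correction term of the preconnection. Hence
  right invariance with \<open>\<Psi>\<close> amounts to \<open>Ad\<^sup>* \<Xi>h(L, s) = (\<Psi> - K)(Ad\<^sup>* L, Ad\<^sup>* s)\<close>
  (\<open>right_invariance_iff\<close>). Bump functions show that \<open>L\<close> and \<open>s\<close> take arbitrary
  values at a given point, so the equation holds for all covectors and all \<open>g\<close>; at \<open>g = 1\<close> it says
  \<open>\<Psi> - K = \<Xi>h\<close>, and what remains is the \<open>Ad\<close>-invariance of \<open>\<Xi>h\<close>. Conversely, \<open>Ad\<close>-invariance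
  makes \<open>\<Psi> = \<Xi>h + K\<close> work.

  The formula for \<open>\<omega>\<close> on a connected group comes from its multiplicativity: the
  right-trivialised difference of \<open>\<omega>\<close> and \<open>g r - r g\<close> is a group cocycle whose derivative at the
  identity vanishes, and such a cocycle is zero (\<open>multiplicative_bivector_eq_coboundary\<close>). As
  \<open>\<omega>\<close> is skew-symmetric, \<open>r\<close> may then be replaced by its skew part.

  The infinitesimal statement is the computation of the derivative of the right-hand side of
  the invariance condition at the identity. Both this and the formula for \<open>t'\<close> rest on the fact that the
  derivative of \<open>Ad\<close> at the identity is the bracket of left-invariant vector fields
  (\<open>has_mderiv_Ad\<close>), which in turn comes down to the symmetry of the second derivative of the
  multiplication in a chart.
\<close>

section \<open>Calculus of smooth maps\<close>

lemma Ck_on_cong: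
  assumes "open S" "\<And>x. x \<in> S \<Longrightarrow> f x = g x" "Ck_on k S f"
  shows "Ck_on k S g"
  using assms(2,3)
proof (induction k arbitrary: f g)
  case 0
  then show ?case by (metis Ck_on.simps(1) continuous_on_cong)
next
  case (Suc k)
  have "(g has_derivative frechet_derivative f (at x)) (at x)" if "x \<in> S" for x
    using Suc.prems that assms(1)
    by (auto simp: frechet_derivative_works intro: has_derivative_transform_within_open)
  then have "g differentiable (at x)" "frechet_derivative g (at x) = frechet_derivative f (at x)"
    if "x \<in> S" for x
    using that by (auto simp: differentiable_def frechet_derivative_at[symmetric])
  then show ?case
    using Suc.prems(2) by (auto intro: Suc.IH[rotated])
qed

lemma Ck_on_Suc_intro:
  assumes "open S" and "\<And>x. x \<in> S \<Longrightarrow> (f has_derivative f' x) (at x)"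
    and "\<And>v. Ck_on k S (\<lambda>x. f' x v)"
  shows "Ck_on (Suc k) S f"
proof -
  have "f differentiable (at x)" "frechet_derivative f (at x) = f' x" if "x \<in> S" for x
    using assms(2)[OF that] by (auto simp: differentiable_def frechet_derivative_at[symmetric])
  then show ?thesis
    using assms(3) Ck_on_cong[OF assms(1), of "\<lambda>x. f' x v" "\<lambda>x. frechet_derivative f (at x) v" k for v]
    by simp
qed

lemma Ck_on_Suc_has_derivative:
  assumes "Ck_on (Suc k) S f" "x \<in> S"
  shows "(f has_derivative frechet_derivative f (at x)) (at x)"
  using assms by (simp add: frechet_derivative_works)

lemma Ck_on_Suc_imp_Ck_on:
  assumes "Ck_on (Suc k) S f"
  shows "Ck_on k S f"
  using assms
proof (induction k arbitrary: f)
  case 0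
  then show ?case
    by (auto intro!: continuous_at_imp_continuous_on differentiable_imp_continuous_within)
qed auto

lemma Ck_on_const: "open S \<Longrightarrow> Ck_on k S (\<lambda>x. c)"
proof (induction k arbitrary: c)
  case (Suc k)
  then show ?case by (intro Ck_on_Suc_intro[where f' = "\<lambda>x v. 0"]) auto
qed auto

lemma Ck_on_add:
  assumes "open S" "Ck_on k S f" "Ck_on k S g"
  shows "Ck_on k S (\<lambda>x. f x + g x)"
  using assms(2,3)
proof (induction k arbitrary: f g)
  case 0
  then show ?case by (auto intro: continuous_on_add)
next
  case (Suc k)
  show ?case
    by (rule Ck_on_Suc_intro[OF assms(1) has_derivative_add[OF Suc.prems[THEN Ck_on_Suc_has_derivative]]])
       (use Suc in auto)
qed

lemma Ck_on_sum:
  assumes "open S" "\<And>i. i \<in> I \<Longrightarrow> Ck_on k S (f i)"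
  shows "Ck_on k S (\<lambda>x. \<Sum>i\<in>I. f i x)"
  using assms(2)
  by (induction I rule: infinite_finite_induct) (auto intro: Ck_on_const Ck_on_add assms(1))

lemma Ck_on_ident: "open S \<Longrightarrow> Ck_on k S (\<lambda>x. x)"
proof (cases k)
  case (Suc k)
  assume "open S"
  then show ?thesis
    unfolding Suc by (intro Ck_on_Suc_intro[where f' = "\<lambda>x v. v"] Ck_on_const) auto
qed auto

lemma Ck_on_bounded_linear:
  assumes "bounded_linear L" "open S" "Ck_on k S f"
  shows "Ck_on k S (\<lambda>x. L (f x))"
  using assms(3)
proof (induction k arbitrary: f)
  case 0
  then show ?case using assms(1) by (auto intro: bounded_linear.continuous_on)
next
  case (Suc k)
  show ?case
    by (rule Ck_on_Suc_intro[OF assms(2) bounded_linear.has_derivative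
          [OF assms(1) Suc.prems[THEN Ck_on_Suc_has_derivative]]])
       (use Suc in auto)
qed

lemma Ck_on_bounded_bilinear:
  assumes "bounded_bilinear B" "open S" "Ck_on k S f" "Ck_on k S g"
  shows "Ck_on k S (\<lambda>x. B (f x) (g x))"
  using assms(3,4)
proof (induction k arbitrary: f g)
  case 0
  then show ?case using assms(1) by (auto intro: bounded_bilinear.continuous_on)
next
  case (Suc k)
  show ?case
    by (rule Ck_on_Suc_intro[OF assms(2) bounded_bilinear.FDERIV
          [OF assms(1) Suc.prems[THEN Ck_on_Suc_has_derivative]]])
       (use Suc in \<open>auto intro!: Ck_on_add assms(2) Suc.IH intro: Ck_on_Suc_imp_Ck_on\<close>)
qed

text \<open>By the chain rule the directional derivatives of a composition are sums of products of
  directional derivatives of the outer map along basis vectors, evaluated at the inner map,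
  with components of derivatives of the inner map. All of these are covered by the
  induction hypothesis.\<close>

lemma Ck_on_compose:
  fixes f :: "'a::euclidean_space \<Rightarrow> 'b::euclidean_space"
  assumes "open S" "open T" "f ` S \<subseteq> T" "Ck_on k S f" "Ck_on k T g"
  shows "Ck_on k S (\<lambda>x. g (f x))"
  using assms(3-5)
proof (induction k arbitrary: g)
  case 0
  then show ?case by (auto intro: continuous_on_compose2)
next
  case (Suc k)
  let ?f' = "\<lambda>x. frechet_derivative f (at x)" and ?g' = "\<lambda>x. frechet_derivative g (at x)"
  have df: "(f has_derivative ?f' x) (at x)" if "x \<in> S" for x
    using Suc.prems that by (intro Ck_on_Suc_has_derivative)
  have dg: "(g has_derivative ?g' y) (at y)" if "y \<in> T" for y
    using Suc.prems that by (intro Ck_on_Suc_has_derivative)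
  show ?case
  proof (rule Ck_on_Suc_intro[OF assms(1)])
    show "((\<lambda>x. g (f x)) has_derivative (\<lambda>v. ?g' (f x) (?f' x v))) (at x)" if "x \<in> S" for x
      by (rule has_derivative_compose[OF df[OF that] dg]) (use Suc.prems that in auto)
    show "Ck_on k S (\<lambda>x. ?g' (f x) (?f' x v))" for v
    proof (rule Ck_on_cong[OF assms(1)])
      show "(\<Sum>b\<in>Basis. (?f' x v \<bullet> b) *\<^sub>R ?g' (f x) b) = ?g' (f x) (?f' x v)" if "x \<in> S" for x
      proof -
        interpret bounded_linear "?g' (f x)"
          using dg Suc.prems(1) that by (auto dest: has_derivative_bounded_linear)
        have "?g' (f x) (?f' x v) = ?g' (f x) (\<Sum>b\<in>Basis. (?f' x v \<bullet> b) *\<^sub>R b)"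
          by (simp add: euclidean_representation)
        then show ?thesis by (simp add: sum scaleR)
      qed
      show "Ck_on k S (\<lambda>x. \<Sum>b\<in>Basis. (?f' x v \<bullet> b) *\<^sub>R ?g' (f x) b)"
        using Suc.prems
        by (intro Ck_on_sum Ck_on_bounded_bilinear[OF bounded_bilinear_scaleR] assms(1)
              Ck_on_bounded_linear[OF bounded_linear_inner_left] Suc.IH Ck_on_Suc_imp_Ck_on[of k S f])
           auto
    qed
  qed
qed

lemma Ck_on_Un:
  assumes "open S" "open T" "Ck_on k S f" "Ck_on k T f"
  shows "Ck_on k (S \<union> T) f"
  using assms(3,4) by (induction k arbitrary: f) (auto intro: continuous_on_open_Un assms(1,2))

lemma smooth_on_openD: "smooth_on S f \<Longrightarrow> open S"
  by (simp add: smooth_on_def)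

lemma smooth_on_cong: "smooth_on S f \<Longrightarrow> (\<And>x. x \<in> S \<Longrightarrow> f x = g x) \<Longrightarrow> smooth_on S g"
  unfolding smooth_on_def by (metis Ck_on_cong)

lemma smooth_on_const: "open S \<Longrightarrow> smooth_on S (\<lambda>x. c)"
  by (simp add: smooth_on_def Ck_on_const)

lemma smooth_on_add:
  "smooth_on S f \<Longrightarrow> smooth_on S g \<Longrightarrow> smooth_on S (\<lambda>x. f x + g x)"
  by (simp add: smooth_on_def Ck_on_add)

lemma smooth_on_sum:
  "open S \<Longrightarrow> (\<And>i. i \<in> I \<Longrightarrow> smooth_on S (f i)) \<Longrightarrow> smooth_on S (\<lambda>x. \<Sum>i\<in>I. f i x)"
  by (simp add: smooth_on_def Ck_on_sum)

lemma smooth_on_bounded_linear: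
  "bounded_linear L \<Longrightarrow> smooth_on S f \<Longrightarrow> smooth_on S (\<lambda>x. L (f x))"
  by (simp add: smooth_on_def Ck_on_bounded_linear)

lemma smooth_on_bounded_bilinear:
  "bounded_bilinear B \<Longrightarrow> smooth_on S f \<Longrightarrow> smooth_on S g \<Longrightarrow> smooth_on S (\<lambda>x. B (f x) (g x))"
  by (simp add: smooth_on_def Ck_on_bounded_bilinear)

lemma smooth_on_compose:
  fixes f :: "'a::euclidean_space \<Rightarrow> 'b::euclidean_space"
  shows "smooth_on S f \<Longrightarrow> smooth_on T g \<Longrightarrow> f ` S \<subseteq> T \<Longrightarrow> smooth_on S (\<lambda>x. g (f x))"
  unfolding smooth_on_def by (blast intro: Ck_on_compose)

lemma smooth_on_Un: "smooth_on S f \<Longrightarrow> smooth_on T f \<Longrightarrow> smooth_on (S \<union> T) f"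
  by (simp add: smooth_on_def Ck_on_Un open_Un)

lemma smooth_on_has_derivative:
  "smooth_on S f \<Longrightarrow> x \<in> S \<Longrightarrow> (f has_derivative frechet_derivative f (at x)) (at x)"
  unfolding smooth_on_def using Ck_on_Suc_has_derivative by blast

lemma smooth_on_frechet_derivative:
  assumes "smooth_on S f"
  shows "smooth_on S (\<lambda>x. frechet_derivative f (at x) v)"
proof -
  have "Ck_on (Suc k) S f" for k using assms by (simp only: smooth_on_def)
  then show ?thesis using assms by (simp add: smooth_on_def)
qed

lemma smooth_on_continuous_on: "smooth_on S f \<Longrightarrow> continuous_on S f"
  unfolding smooth_on_def using Ck_on.simps(1) by blast


section \<open>Bump functions\<close>

text \<open>The functions \<open>x\<^sup>-\<^sup>n exp (-1/x)\<close>, extended by zero to the left half-line. The family is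
  closed under differentiation up to linear combinations, so smoothness follows for all
  members at once.\<close>

definition flat :: "nat \<Rightarrow> real \<Rightarrow> real" where
  "flat n x = (if x > 0 then inverse x ^ n * exp (- inverse x) else 0)"

text \<open>Quadratic decay at zero, which makes the derivative at zero vanish: the exponential
  dominates one term of its power series at \<open>1/x\<close>.\<close>

lemma flat_le: "\<bar>flat n x\<bar> \<le> fact (n + 2) * x\<^sup>2"
proof (cases "x > 0")
  case True
  let ?y = "inverse x"
  define N :: real where "N = fact (n + 2)"
  have N: "N > 0" by (simp add: N_def)
  have "?y ^ (n + 2) / N \<le> exp ?y"
  proof -
    have "(\<lambda>k. ?y ^ k /\<^sub>R fact k) sums exp ?y"
      by (rule exp_converges)
    then have "summable (\<lambda>k. ?y ^ k /\<^sub>R fact k)" "exp ?y = (\<Sum>k. ?y ^ k /\<^sub>R fact k)"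
      by (auto simp: sums_iff)
    then have "(\<Sum>k\<in>{n+2}. ?y ^ k /\<^sub>R fact k) \<le> exp ?y"
      using True sum_le_suminf[of "\<lambda>k. ?y ^ k /\<^sub>R fact k" "{n+2}"] by simp
    then show ?thesis by (simp add: N_def divide_inverse mult.commute del: fact_Suc)
  qed
  then have "?y ^ n * ?y\<^sup>2 \<le> N * exp ?y"
    using N by (simp only: power_add pos_divide_le_eq) (simp add: mult.commute)
  then have "?y ^ n * ?y\<^sup>2 * exp (- ?y) \<le> N * exp ?y * exp (- ?y)"
    by (intro mult_right_mono) auto
  then have "?y ^ n * exp (- ?y) * ?y\<^sup>2 \<le> N"
    by (simp add: exp_minus mult_ac)
  then have "?y ^ n * exp (- ?y) * ?y\<^sup>2 * x\<^sup>2 \<le> N * x\<^sup>2"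
    by (intro mult_right_mono) auto
  moreover have "?y ^ n * exp (- ?y) * ?y\<^sup>2 * x\<^sup>2 = flat n x"
    using True by (simp add: flat_def power2_eq_square field_simps)
  moreover have "flat n x \<ge> 0"
    using True by (simp add: flat_def)
  ultimately show ?thesis by (simp only: N_def abs_of_nonneg)
qed (simp add: flat_def)

lemma flat_has_derivative:
  "(flat n has_real_derivative (flat (n + 2) x - n * flat (n + 1) x)) (at x)"
proof (cases x "0::real" rule: linorder_cases)
  case less
  have "((\<lambda>x. 0) has_real_derivative 0) (at x)" by simp
  then have "(flat n has_real_derivative 0) (at x)"
    by (rule has_field_derivative_transform_within_open[where S = "{..<0}"])
       (use less in \<open>auto simp: flat_def\<close>)
  then show ?thesis using less by (simp add: flat_def)
next
  case equal
  have "((\<lambda>h. flat n h / h) \<longlongrightarrow> 0) (at 0)"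
  proof (rule Lim_null_comparison)
    have "\<bar>flat n h / h\<bar> \<le> fact (n + 2) * \<bar>h\<bar>" for h
    proof (cases "h = 0")
      case False
      have "\<bar>flat n h\<bar> \<le> (fact (n + 2) * \<bar>h\<bar>) * \<bar>h\<bar>"
        using flat_le[of n h] by (simp only: power2_eq_square mult.assoc abs_mult_self_eq)
      then show ?thesis using False by (simp only: abs_divide) (simp add: divide_le_eq)
    qed simp
    then show "\<forall>\<^sub>F h in at 0. norm (flat n h / h) \<le> fact (n + 2) * \<bar>h\<bar>" by simp
    show "((\<lambda>h::real. fact (n + 2) * \<bar>h\<bar>) \<longlongrightarrow> 0) (at 0)"
      by (auto intro!: tendsto_eq_intros)
  qed
  then show ?thesis using equal by (simp add: has_field_derivative_iff flat_def)
next
  case greater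
  have "((\<lambda>x. inverse x ^ n) has_real_derivative - (n * inverse x ^ (n + 1))) (at x)"
    using greater DERIV_power[OF DERIV_inverse[of x], of n] by (cases n) (auto simp: mult.assoc)
  moreover have "((\<lambda>x. exp (- inverse x)) has_real_derivative exp (- inverse x) * (inverse x)\<^sup>2) (at x)"
    using greater by (auto intro!: derivative_eq_intros simp: power2_eq_square)
  ultimately have "((\<lambda>x. inverse x ^ n * exp (- inverse x)) has_real_derivative
      (flat (n + 2) x - n * flat (n + 1) x)) (at x)"
    using greater by (auto intro!: DERIV_cong[OF DERIV_mult]
        simp: flat_def algebra_simps power2_eq_square)
  then show ?thesis
    by (rule has_field_derivative_transform_within_open[where S = "{0<..}"])
       (use greater in \<open>auto simp: flat_def\<close>)
qed

lemma smooth_on_flat: "smooth_on UNIV (flat n)"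
proof -
  have "Ck_on k UNIV (flat n)" for k
  proof (induction k arbitrary: n)
    case 0
    show ?case
      using flat_has_derivative
      by (auto intro!: continuous_at_imp_continuous_on DERIV_isCont)
  next
    case (Suc k)
    show ?case
    proof (rule Ck_on_Suc_intro)
      show "(flat n has_derivative (\<lambda>v. v *\<^sub>R (flat (n + 2) x + (- real n) *\<^sub>R flat (n + 1) x))) (at x)" for x
        using flat_has_derivative[of n x]
        by (simp add: has_field_derivative_def mult.commute[of _ "_ - _"] fun_eq_iff)
    qed (intro Ck_on_bounded_linear[OF bounded_linear_scaleR_right] Ck_on_add Suc.IH open_UNIV)+
  qed
  then show ?thesis by (simp add: smooth_on_def)
qed

text \<open>A smooth function with value 1 at the centre and support in the closed ball. Cutting
  off a quantity that vanishes at the centre does not change its first derivative there, so this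
  formula without a plateau suffices.\<close>

definition bump :: "'a::euclidean_space \<Rightarrow> real \<Rightarrow> 'a \<Rightarrow> real" where
  "bump c R x = flat 0 (R\<^sup>2 - (x - c) \<bullet> (x - c)) / flat 0 (R\<^sup>2)"

lemma bump_center: "R > 0 \<Longrightarrow> bump c R c = 1"
  by (simp add: bump_def flat_def)

lemma bump_outside:
  assumes "R > 0" "x \<notin> cball c R"
  shows "bump c R x = 0"
proof -
  have "R\<^sup>2 \<le> (norm (x - c))\<^sup>2"
    using assms by (intro power_mono) (auto simp: dist_norm norm_minus_commute)
  then show ?thesis by (simp add: bump_def flat_def power2_norm_eq_inner)
qed

lemma smooth_on_bump: "smooth_on UNIV (bump c R :: 'a::euclidean_space \<Rightarrow> real)"
proof -
  have s: "smooth_on UNIV (\<lambda>x::'a. x + (- c))"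
    unfolding smooth_on_def by (intro conjI allI open_UNIV Ck_on_add Ck_on_ident Ck_on_const)
  have "smooth_on UNIV (\<lambda>x. R\<^sup>2 + (- 1) *\<^sub>R ((x + (- c)) \<bullet> (x + (- c))))"
    using smooth_on_bounded_bilinear[OF bounded_bilinear_inner s s] unfolding smooth_on_def
    by (intro conjI allI open_UNIV Ck_on_add Ck_on_const
          Ck_on_bounded_linear[OF bounded_linear_scaleR_right]) blast
  from smooth_on_compose[OF this smooth_on_flat[of 0]]
  have "smooth_on UNIV (\<lambda>x. inverse (flat 0 (R\<^sup>2)) *\<^sub>R flat 0 (R\<^sup>2 + (- 1) *\<^sub>R ((x + (- c)) \<bullet> (x + (- c)))))"
    by (intro smooth_on_bounded_linear[OF bounded_linear_scaleR_right]) auto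
  then show ?thesis
    by (rule smooth_on_cong) (simp add: bump_def divide_inverse mult.commute)
qed


section \<open>Symmetry of second derivatives\<close>

text \<open>The second difference quotient of \<open>f\<close> along \<open>v\<close> and \<open>w\<close> is a value of a mixed second
  derivative at a nearby point, by two applications of the mean value theorem; the quotient
  itself does not depend on the order of \<open>v\<close> and \<open>w\<close>.\<close>

lemma second_difference_mean_value:
  fixes f :: "'a::real_normed_vector \<Rightarrow> real"
  assumes f': "\<And>x. x \<in> ball p \<rho> \<Longrightarrow> (f has_derivative f' x) (at x)"
    and f'': "\<And>x. x \<in> ball p \<rho> \<Longrightarrow> ((\<lambda>x. f' x v) has_derivative f'' x) (at x)"
    and t: "t > 0" "t * (norm v + norm w) < \<rho>"
  obtains q where "dist p q \<le> t * (norm v + norm w)"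
    and "f (p + t *\<^sub>R v + t *\<^sub>R w) - f (p + t *\<^sub>R v) - f (p + t *\<^sub>R w) + f p = t\<^sup>2 * f'' q w"
proof -
  have near: "dist p (p + s *\<^sub>R v + u *\<^sub>R w) \<le> t * (norm v + norm w)"
    if "0 \<le> s" "s \<le> t" "0 \<le> u" "u \<le> t" for s u
  proof -
    have "norm (s *\<^sub>R v + u *\<^sub>R w) \<le> s * norm v + u * norm w"
      using norm_triangle_ineq[of "s *\<^sub>R v" "u *\<^sub>R w"] that by simp
    also have "\<dots> \<le> t * (norm v + norm w)"
      using that by (simp add: distrib_left add_mono mult_right_mono)
    finally show ?thesis by (metis add.assoc dist_0_norm dist_add_cancel add_0_right)
  qed
  then have in_ball: "p + s *\<^sub>R v + u *\<^sub>R w \<in> ball p \<rho>"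
    if "0 \<le> s" "s \<le> t" "0 \<le> u" "u \<le> t" for s u
    using that t by (meson mem_ball le_less_trans)
  have dv: "((\<lambda>s. f (p + s *\<^sub>R v + u *\<^sub>R w)) has_real_derivative f' (p + s *\<^sub>R v + u *\<^sub>R w) v) (at s)"
    if "0 \<le> s" "s \<le> t" "0 \<le> u" "u \<le> t" for s u
  proof -
    have lin: "f' (p + s *\<^sub>R v + u *\<^sub>R w) (h *\<^sub>R v) = f' (p + s *\<^sub>R v + u *\<^sub>R w) v * h" for h
      using linear_scale[OF bounded_linear.linear[OF has_derivative_bounded_linear[OF f'[OF in_ball[OF that]]]]]
      by (simp add: mult.commute)
    show ?thesis
      unfolding has_field_derivative_def
      by (rule has_derivative_eq_rhs[OF has_derivative_compose
            [where f = "\<lambda>s. p + s *\<^sub>R v + u *\<^sub>R w" and g = f, OF _ f'[OF in_ball[OF that]]]])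
         (auto intro!: derivative_eq_intros simp: lin)
  qed
  let ?g = "\<lambda>s. f (p + s *\<^sub>R v + t *\<^sub>R w) - f (p + s *\<^sub>R v + 0 *\<^sub>R w)"
  have "\<exists>s>0. s < t \<and> ?g t - ?g 0 =
      (t - 0) * (f' (p + s *\<^sub>R v + t *\<^sub>R w) v - f' (p + s *\<^sub>R v + 0 *\<^sub>R w) v)"
    by (rule MVT2[OF t(1)], intro DERIV_diff dv) (use t in auto)
  then obtain s where s: "0 < s" "s < t"
    and g: "?g t - ?g 0 = t * (f' (p + s *\<^sub>R v + t *\<^sub>R w) v - f' (p + s *\<^sub>R v + 0 *\<^sub>R w) v)"
    by auto
  have dw: "((\<lambda>u. f' (p + s *\<^sub>R v + u *\<^sub>R w) v) has_real_derivative f'' (p + s *\<^sub>R v + u *\<^sub>R w) w) (at u)"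
    if "0 \<le> u" "u \<le> t" for u
  proof -
    have s': "0 \<le> s" "s \<le> t" using s by auto
    note f'' = f''[OF in_ball[OF s' that]]
    have lin: "f'' (p + s *\<^sub>R v + u *\<^sub>R w) (h *\<^sub>R w) = f'' (p + s *\<^sub>R v + u *\<^sub>R w) w * h" for h
      using linear_scale[OF bounded_linear.linear[OF has_derivative_bounded_linear[OF f'']]]
      by (simp add: mult.commute)
    show ?thesis
      unfolding has_field_derivative_def
      by (rule has_derivative_eq_rhs[OF has_derivative_compose
            [where f = "\<lambda>u. p + s *\<^sub>R v + u *\<^sub>R w" and g = "\<lambda>x. f' x v", OF _ f'']])
         (auto intro!: derivative_eq_intros simp: lin)
  qed
  have "\<exists>u>0. u < t \<and> f' (p + s *\<^sub>R v + t *\<^sub>R w) v - f' (p + s *\<^sub>R v + 0 *\<^sub>R w) v =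
      (t - 0) * f'' (p + s *\<^sub>R v + u *\<^sub>R w) w"
    by (rule MVT2) (use t dw in auto)
  then obtain u where "0 < u" "u < t"
    and h: "f' (p + s *\<^sub>R v + t *\<^sub>R w) v - f' (p + s *\<^sub>R v + 0 *\<^sub>R w) v = t * f'' (p + s *\<^sub>R v + u *\<^sub>R w) w"
    by auto
  show thesis
  proof (rule that)
    show "dist p (p + s *\<^sub>R v + u *\<^sub>R w) \<le> t * (norm v + norm w)"
      using s \<open>0 < u\<close> \<open>u < t\<close> by (intro near) auto
    show "f (p + t *\<^sub>R v + t *\<^sub>R w) - f (p + t *\<^sub>R v) - f (p + t *\<^sub>R w) + f p =
        t\<^sup>2 * f'' (p + s *\<^sub>R v + u *\<^sub>R w) w"
      using g unfolding h by (simp add: power2_eq_square)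
  qed
qed

text \<open>Evaluating the same second difference in both orders gives values of the two mixed
  derivatives at two points near \<open>p\<close>; continuity brings both points to \<open>p\<close>.\<close>

lemma second_derivative_symmetric_real:
  fixes f :: "'a::real_normed_vector \<Rightarrow> real"
  assumes S: "open S" "p \<in> S"
    and f': "\<And>x. x \<in> S \<Longrightarrow> (f has_derivative f' x) (at x)"
    and f'': "\<And>u x. x \<in> S \<Longrightarrow> ((\<lambda>x. f' x u) has_derivative f'' u x) (at x)"
    and cont: "\<And>u h. continuous_on S (\<lambda>x. f'' u x h)"
  shows "f'' v p w = f'' w p v"
proof (rule ccontr)
  assume ne: "f'' v p w \<noteq> f'' w p v"
  define e where "e = \<bar>f'' v p w - f'' w p v\<bar> / 2"
  have "e > 0" using ne by (simp add: e_def)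
  have "\<exists>d>0. \<forall>x. dist x p < d \<longrightarrow> \<bar>f'' u x h - f'' u p h\<bar> < e" for u h
    using cont[of u h] S \<open>e > 0\<close>
    by (auto simp: continuous_on_eq_continuous_at continuous_at_eps_delta dist_real_def)
  then obtain d1 d2 where d: "d1 > 0" "d2 > 0"
    and d1: "\<And>x. dist x p < d1 \<Longrightarrow> \<bar>f'' v x w - f'' v p w\<bar> < e"
    and d2: "\<And>x. dist x p < d2 \<Longrightarrow> \<bar>f'' w x v - f'' w p v\<bar> < e"
    by meson
  obtain \<rho> where \<rho>: "\<rho> > 0" "ball p \<rho> \<subseteq> S"
    using S openE by blast
  define m where "m = min \<rho> (min d1 d2)"
  \<comment> \<open>the summand 1 keeps the denominator positive when both vectors vanish\<close>
  define t where "t = m / (norm v + norm w + 1)"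
  have m: "m > 0" using d \<rho> by (simp add: m_def)
  have nz: "norm v + norm w + 1 > 0"
    by (meson add_nonneg_pos norm_ge_zero add_nonneg_nonneg zero_less_one)
  then have t: "t > 0" "t * (norm v + norm w) < m"
    using m by (auto simp: t_def field_simps)
  then have t': "t * (norm v + norm w) < \<rho>" "t * (norm w + norm v) < \<rho>"
    by (auto simp: m_def add.commute)
  obtain q1 where q1: "dist p q1 \<le> t * (norm v + norm w)"
    "f (p + t *\<^sub>R v + t *\<^sub>R w) - f (p + t *\<^sub>R v) - f (p + t *\<^sub>R w) + f p = t\<^sup>2 * f'' v q1 w"
    by (rule second_difference_mean_value[of p \<rho> f f' v "f'' v" t w]) (use f' f'' \<rho> t t' in auto)
  obtain q2 where q2: "dist p q2 \<le> t * (norm w + norm v)"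
    "f (p + t *\<^sub>R w + t *\<^sub>R v) - f (p + t *\<^sub>R w) - f (p + t *\<^sub>R v) + f p = t\<^sup>2 * f'' w q2 v"
    by (rule second_difference_mean_value[of p \<rho> f f' w "f'' w" t v]) (use f' f'' \<rho> t t' in auto)
  have "p + t *\<^sub>R w + t *\<^sub>R v = p + t *\<^sub>R v + t *\<^sub>R w" by simp
  then have "t\<^sup>2 * f'' v q1 w = t\<^sup>2 * f'' w q2 v"
    using q1(2) q2(2) by (simp only:) 
  then have "f'' v q1 w = f'' w q2 v" using t by simp
  moreover have "\<bar>f'' v q1 w - f'' v p w\<bar> < e"
    by (rule d1) (use q1(1) t in \<open>auto simp: m_def dist_commute\<close>)
  moreover have "\<bar>f'' w q2 v - f'' w p v\<bar> < e"
    by (rule d2) (use q2(1) t in \<open>auto simp: m_def dist_commute add.commute\<close>)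
  moreover have "\<bar>f'' v p w - f'' w p v\<bar> = 2 * e" by (simp add: e_def)
  ultimately show False by linarith
qed

lemma smooth_on_second_derivative_symmetric:
  fixes f :: "'a::euclidean_space \<Rightarrow> 'b::euclidean_space"
  assumes "smooth_on S f" "p \<in> S"
  shows "frechet_derivative (\<lambda>x. frechet_derivative f (at x) v) (at p) w =
         frechet_derivative (\<lambda>x. frechet_derivative f (at x) w) (at p) v"
proof (rule euclidean_eqI)
  fix b :: 'b
  let ?f' = "\<lambda>x. frechet_derivative f (at x)"
  let ?f'' = "\<lambda>u x. frechet_derivative (\<lambda>x. ?f' x u) (at x)"
  note inner = bounded_linear.has_derivative[OF bounded_linear_inner_left]
  note s' = smooth_on_frechet_derivative[OF assms(1)]
  show "?f'' v p w \<bullet> b = ?f'' w p v \<bullet> b"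
  proof (rule second_derivative_symmetric_real[of S p "\<lambda>x. f x \<bullet> b" "\<lambda>x u. ?f' x u \<bullet> b"
        "\<lambda>u x h. ?f'' u x h \<bullet> b"])
    show "continuous_on S (\<lambda>x. ?f'' u x h \<bullet> b)" for u h
      by (intro continuous_on_inner continuous_on_const smooth_on_continuous_on
            smooth_on_frechet_derivative[OF s'])
  qed (use assms s' in \<open>auto intro!: inner smooth_on_has_derivative intro: smooth_on_openD\<close>)
qed


section \<open>Tensors and contractions\<close>

lemma covec_expand:
  fixes \<phi> :: "'e::euclidean_space covec"
  shows "\<phi> = (\<Sum>b\<in>Basis. \<phi> b *\<^sub>R blinfun_inner_left b)"
proof (rule blinfun_eqI)
  fix x :: 'e
  have "\<phi> x = \<phi> (\<Sum>b\<in>Basis. (x \<bullet> b) *\<^sub>R b)" by (simp add: euclidean_representation)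
  then show "\<phi> x = (\<Sum>b\<in>Basis. \<phi> b *\<^sub>R blinfun_inner_left b) x"
    by (simp add: blinfun.sum_right blinfun.sum_left blinfun.scaleR_left blinfun.scaleR_right mult.commute inner_commute)
qed

lemma bilinear_covec_expand:
  fixes f :: "'e::euclidean_space covec \<Rightarrow> 'e covec \<Rightarrow> 'b::real_vector"
  assumes "bilinear f"
  shows "f \<phi> \<psi> = (\<Sum>i\<in>Basis. \<Sum>j\<in>Basis. (\<phi> i * \<psi> j) *\<^sub>R f (blinfun_inner_left i) (blinfun_inner_left j))"
proof -
  have l: "linear (f u)" and r: "linear (\<lambda>u. f u v)" for u v
    using assms by (auto simp: bilinear_def)
  have "f \<phi> \<psi> = f (\<Sum>b\<in>Basis. \<phi> b *\<^sub>R blinfun_inner_left b) (\<Sum>b\<in>Basis. \<psi> b *\<^sub>R blinfun_inner_left b)"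
    using covec_expand[of \<phi>] covec_expand[of \<psi>] by simp
  also have "\<dots> = (\<Sum>i\<in>Basis. \<Sum>j\<in>Basis. (\<phi> i * \<psi> j) *\<^sub>R f (blinfun_inner_left i) (blinfun_inner_left j))"
    by (subst linear_sum[OF r], simp only: linear_scale[OF r], subst linear_sum[OF l])
       (simp add: linear_scale[OF l] scaleR_sum_right)
  finally show ?thesis .
qed

text \<open>Bilinear maps on covectors are continuous because the dual space is finite-dimensional.\<close>

lemma bilinear_covec_bounded:
  fixes f :: "'e::euclidean_space covec \<Rightarrow> 'e covec \<Rightarrow> 'b::real_normed_vector"
  assumes "bilinear f"
  shows "bounded_bilinear f"
proof -
  let ?K = "\<Sum>i\<in>Basis. \<Sum>j\<in>Basis. norm (f (blinfun_inner_left i) (blinfun_inner_left j))"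
  have le: "norm (f \<phi> \<psi>) \<le> norm \<phi> * norm \<psi> * ?K" for \<phi> \<psi>
  proof -
    have "\<bar>\<phi> i\<bar> * \<bar>\<psi> j\<bar> \<le> norm \<phi> * norm \<psi>" if "i \<in> Basis" "j \<in> Basis" for i j
      using norm_blinfun[of \<phi> i] norm_blinfun[of \<psi> j] that by (intro mult_mono) auto
    then have "norm (f \<phi> \<psi>) \<le> (\<Sum>i\<in>Basis. \<Sum>j\<in>Basis.
        norm \<phi> * norm \<psi> * norm (f (blinfun_inner_left i) (blinfun_inner_left j)))"
      unfolding bilinear_covec_expand[OF assms, of \<phi> \<psi>]
      by (intro sum_norm_le) (auto simp: abs_mult intro!: mult_right_mono)
    then show ?thesis by (simp add: sum_distrib_left)
  qed
  show ?thesis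
    by (unfold_locales)
       (use assms le in \<open>auto simp: bilinear_ladd bilinear_radd bilinear_lmul bilinear_rmul\<close>)
qed

lemma tens2_eqI:
  fixes s t :: "'e::euclidean_space tens2"
  shows "(\<And>\<phi> \<psi>. s \<phi> \<psi> = t \<phi> \<psi>) \<Longrightarrow> s = t"
  by (intro blinfun_eqI)

lemma bounded_bilinear_tensor: "bounded_bilinear (tensor :: 'e::euclidean_space \<Rightarrow> 'e \<Rightarrow> 'e tens2)"
proof -
  have "bilinear (tensor :: 'e \<Rightarrow> 'e \<Rightarrow> 'e tens2)"
    by (auto simp: bilinear_def intro!: linearI tens2_eqI
        simp: tensor_apply blinfun.add_left blinfun.add_right blinfun.scaleR_left blinfun.scaleR_right algebra_simps)
  then show ?thesis by (simp add: bilinear_conv_bounded_bilinear)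
qed

lemma linear_contract: "linear (contract f)"
  by (auto intro!: linearI simp: contract_def blinfun.add_left blinfun.scaleR_left
      algebra_simps sum.distrib scaleR_sum_right)

lemmas contract_diff = linear_diff[OF linear_contract]

lemma contract_plus: "contract (\<lambda>x y. f x y + g x y) t = contract f t + contract g t"
  by (simp add: contract_def algebra_simps sum.distrib)

lemma linear_contract_commute: "linear L \<Longrightarrow> L (contract f t) = contract (\<lambda>x y. L (f x y)) t"
  by (simp add: contract_def linear_sum linear_scale)

lemma blinfun_apply_contract: "blinfun_apply (contract f t) u = contract (\<lambda>x y. blinfun_apply (f x y) u) t"
  by (rule linear_contract_commute) (auto intro!: linearI simp: blinfun.add_left blinfun.scaleR_left)

text \<open>Contracting with the bilinear form \<open>\<phi> \<otimes> \<psi>\<close> is evaluation; this converts between contractions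
  and the representation of tensors as forms.\<close>

lemma contract_eval:
  fixes t :: "'e::euclidean_space tens2" and \<phi> \<psi> :: "'e covec"
  shows "contract (\<lambda>x y. \<phi> x * \<psi> y) t = t \<phi> \<psi>"
proof -
  have "bilinear (\<lambda>\<phi> \<psi>. t \<phi> \<psi>)"
    by (auto simp: bilinear_def blinfun.add_left blinfun.scaleR_left blinfun.add_right blinfun.scaleR_right intro!: linearI)
  from bilinear_covec_expand[OF this, of \<phi> \<psi>] show ?thesis
    by (simp add: contract_def mult.commute)
qed

lemma flip_apply: "flip t \<phi> \<psi> = t \<psi> \<phi>"
  using contract_eval[of \<psi> \<phi> t] by (simp add: flip_def blinfun_apply_contract tensor_apply mult.commute)

lemma skew_part_apply: "skew_part t \<phi> \<psi> = (t \<phi> \<psi> - t \<psi> \<phi>) / 2"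
  by (simp add: skew_part_def blinfun.diff_left blinfun.scaleR_left flip_apply)

text \<open>The transpose of a linear map.\<close>

definition pullback :: "('e::euclidean_space \<Rightarrow> 'e) \<Rightarrow> 'e covec \<Rightarrow> 'e covec" where
  "pullback T \<phi> = Blinfun (\<lambda>v. \<phi> (T v))"

lemma pullback_apply: "linear T \<Longrightarrow> pullback T \<phi> v = \<phi> (T v)"
  unfolding pullback_def
  by (subst bounded_linear_Blinfun_apply)
     (auto intro!: bounded_linear_compose[OF blinfun.bounded_linear_right] linear_linear[THEN iffD1]
       simp: linear_conv_bounded_linear)

text \<open>The action \<open>T \<otimes> T\<close> of a linear map on the tensor square.\<close>

definition tens_map :: "('e::euclidean_space \<Rightarrow> 'e) \<Rightarrow> 'e tens2 \<Rightarrow> 'e tens2" where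
  "tens_map T t = contract (\<lambda>x y. tensor (T x) (T y)) t"

lemma tens_map_apply: "linear T \<Longrightarrow> tens_map T t \<phi> \<psi> = t (pullback T \<phi>) (pullback T \<psi>)"
  using contract_eval[of "pullback T \<phi>" "pullback T \<psi>" t]
  by (simp add: tens_map_def blinfun_apply_contract tensor_apply pullback_apply)

lemma pullback_pullback: "linear S \<Longrightarrow> linear T \<Longrightarrow> pullback T (pullback S \<phi>) = pullback (S \<circ> T) \<phi>"
  by (intro blinfun_eqI) (simp add: pullback_apply linear_compose)

lemma pullback_id: "pullback (\<lambda>x. x) \<phi> = \<phi>"
  by (intro blinfun_eqI) (simp add: pullback_apply linear_ident)

lemma linear_pullback: "linear T \<Longrightarrow> linear (pullback T)"
  by (auto intro!: linearI blinfun_eqI simp: pullback_apply blinfun.add_left blinfun.scaleR_left)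

lemma tens_map_tens_map:
  "linear S \<Longrightarrow> linear T \<Longrightarrow> tens_map S (tens_map T t) = tens_map (S \<circ> T) t"
  by (intro tens2_eqI) (simp add: tens_map_apply pullback_pullback linear_compose)

lemma tens_map_id: "tens_map (\<lambda>x. x) t = t"
  by (intro tens2_eqI) (simp add: tens_map_apply pullback_id linear_ident)

lemma linear_tens_map: "linear (tens_map T)"
  using linear_contract unfolding tens_map_def .

lemma contract_tens_map:
  assumes "bilinear f"
  shows "contract f (tens_map T t) = contract (\<lambda>x y. f (T x) (T y)) t"
  by (simp add: tens_map_def linear_contract_commute[OF linear_contract] contract_tensor[OF assms])

lemma tens_map_skew_part: "linear T \<Longrightarrow> tens_map T (skew_part t) = skew_part (tens_map T t)"
  by (intro tens2_eqI) (simp add: tens_map_apply skew_part_apply)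

text \<open>Maps into the dual and into the tensor square can be differentiated componentwise, since they
  are finite combinations of a fixed basis.\<close>

lemma has_derivative_covec:
  fixes F F' :: "'x::real_normed_vector \<Rightarrow> 'e::euclidean_space covec"
  assumes "\<And>v. ((\<lambda>x. F x v) has_derivative (\<lambda>h. F' h v)) net"
  shows "(F has_derivative F') net"
proof -
  have "((\<lambda>x. \<Sum>b\<in>Basis. F x b *\<^sub>R blinfun_inner_left b) has_derivative
         (\<lambda>h. \<Sum>b\<in>Basis. F' h b *\<^sub>R blinfun_inner_left b)) net"
    by (intro has_derivative_sum has_derivative_scaleR_left assms)
  then show ?thesis by (simp add: covec_expand[symmetric])
qed

lemma differentiable_covec:
  fixes F :: "'x::real_normed_vector \<Rightarrow> 'e::euclidean_space covec"
  assumes "\<And>v. (\<lambda>x. F x v) differentiable net"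
  shows "F differentiable net"
proof -
  have d: "((\<lambda>x. F x v) has_derivative frechet_derivative (\<lambda>x. F x v) net) net" for v
    using assms by (simp only: frechet_derivative_works)
  have "((\<lambda>x. \<Sum>b\<in>Basis. F x b *\<^sub>R blinfun_inner_left b) has_derivative
      (\<lambda>h. \<Sum>b\<in>Basis. frechet_derivative (\<lambda>x. F x b) net h *\<^sub>R blinfun_inner_left b)) net"
    by (intro has_derivative_sum has_derivative_scaleR_left d)
  then have "(\<lambda>x. \<Sum>b\<in>Basis. F x b *\<^sub>R blinfun_inner_left b) differentiable net"
    unfolding differentiable_def by - (rule exI)
  then show ?thesis by (simp add: covec_expand[symmetric])
qed

lemma tens2_expand:
  fixes t :: "'e::euclidean_space tens2"
  shows "t = (\<Sum>i\<in>Basis. \<Sum>j\<in>Basis. t (blinfun_inner_left i) (blinfun_inner_left j) *\<^sub>R tensor i j)"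
  using tens_map_id[of t] by (simp add: tens_map_def contract_def)

lemma has_derivative_tens2:
  fixes F F' :: "'x::real_normed_vector \<Rightarrow> 'e::euclidean_space tens2"
  assumes "\<And>\<phi> \<psi>. ((\<lambda>x. F x \<phi> \<psi>) has_derivative (\<lambda>h. F' h \<phi> \<psi>)) net"
  shows "(F has_derivative F') net"
proof -
  have "((\<lambda>x. \<Sum>i\<in>Basis. \<Sum>j\<in>Basis. F x (blinfun_inner_left i) (blinfun_inner_left j) *\<^sub>R tensor i j)
      has_derivative (\<lambda>h. \<Sum>i\<in>Basis. \<Sum>j\<in>Basis.
         F' h (blinfun_inner_left i) (blinfun_inner_left j) *\<^sub>R tensor i j)) net"
    by (intro has_derivative_sum has_derivative_scaleR_left assms)
  then show ?thesis by (simp add: tens2_expand[symmetric])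
qed

text \<open>The product rule for applying a varying linear map to a varying vector, when the linear
  map is only known to be differentiable at each fixed vector.\<close>

lemma has_derivative_apply_linear_family:
  fixes u :: "'x::real_normed_vector \<Rightarrow> 'e::euclidean_space"
    and A :: "'x \<Rightarrow> 'e \<Rightarrow> 'b::real_normed_vector"
  assumes A: "\<And>w. ((\<lambda>x. A x w) has_derivative A' w) (at p)"
    and lin: "\<forall>\<^sub>F x in nhds p. linear (A x)"
    and u: "(u has_derivative u') (at p)"
  shows "((\<lambda>x. A x (u x)) has_derivative (\<lambda>h. A' (u p) h + A p (u' h))) (at p)"
proof -
  obtain S where S: "open S" "p \<in> S" "\<And>x. x \<in> S \<Longrightarrow> linear (A x)"
    using lin by (auto simp: eventually_nhds)
  have expand: "A x w = (\<Sum>b\<in>Basis. (w \<bullet> b) *\<^sub>R A x b)" if "x \<in> S" for x w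
  proof -
    have "A x w = A x (\<Sum>b\<in>Basis. (w \<bullet> b) *\<^sub>R b)" by (simp add: euclidean_representation)
    then show ?thesis by (simp add: linear_sum[OF S(3)[OF that]] linear_scale[OF S(3)[OF that]])
  qed
  have "((\<lambda>x. \<Sum>b\<in>Basis. (w \<bullet> b) *\<^sub>R A x b) has_derivative (\<lambda>h. \<Sum>b\<in>Basis. (w \<bullet> b) *\<^sub>R A' b h)) (at p)" for w
    by (intro has_derivative_sum has_derivative_scaleR_right A)
  then have "((\<lambda>x. A x w) has_derivative (\<lambda>h. \<Sum>b\<in>Basis. (w \<bullet> b) *\<^sub>R A' b h)) (at p)" for w
    by (rule has_derivative_transform_within_open[OF _ S(1,2)]) (simp add: expand)
  then have expand': "A' w = (\<lambda>h. \<Sum>b\<in>Basis. (w \<bullet> b) *\<^sub>R A' b h)" for w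
    using A has_derivative_unique by blast
  have "((\<lambda>x. \<Sum>b\<in>Basis. (u x \<bullet> b) *\<^sub>R A x b) has_derivative
      (\<lambda>h. \<Sum>b\<in>Basis. (u p \<bullet> b) *\<^sub>R A' b h + (u' h \<bullet> b) *\<^sub>R A p b)) (at p)"
    by (intro has_derivative_sum has_derivative_scaleR
          bounded_linear.has_derivative[OF bounded_linear_inner_left] u A)
  then have "((\<lambda>x. A x (u x)) has_derivative
      (\<lambda>h. \<Sum>b\<in>Basis. (u p \<bullet> b) *\<^sub>R A' b h + (u' h \<bullet> b) *\<^sub>R A p b)) (at p)"
    by (rule has_derivative_transform_within_open[OF _ S(1,2)]) (simp add: expand)
  then show ?thesis
    using S(2) by (simp add: sum.distrib expand[symmetric] expand'[of "u p", symmetric] fun_cong[OF expand', symmetric])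
qed

lemma has_derivative_tens_map:
  assumes T: "\<And>w. ((\<lambda>x. T x w) has_derivative T' w) (at p)"
    and t: "(t has_derivative t') (at p)"
  shows "((\<lambda>x. tens_map (T x) (t x)) has_derivative
    (\<lambda>h. contract (\<lambda>x y. tensor (T' x h) (T p y) + tensor (T p x) (T' y h)) (t p) + tens_map (T p) (t' h))) (at p)"
proof -
  have c: "((\<lambda>x. t x \<phi> \<psi>) has_derivative (\<lambda>h. t' h \<phi> \<psi>)) (at p)" for \<phi> \<psi>
    by (intro bounded_linear.has_derivative[OF blinfun.bounded_linear_left] t)
  show ?thesis
    unfolding tens_map_def contract_def sum.distrib[symmetric]
    by (rule has_derivative_eq_rhs)
       (rule has_derivative_sum has_derivative_scaleR bounded_bilinear.FDERIV[OF bounded_bilinear_tensor] c T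
          | simp add: algebra_simps)+
qed

section \<open>Derivatives in charts\<close>

text \<open>Relational counterparts of the derivative of a function and of the tangent map. They
  assert differentiability, which the functional versions leave open, and so they obey a chain
  rule. Continuity is part of \<open>has_tmap\<close> so that points near \<open>p\<close> are sent into the chart around
  \<open>F p\<close>, outside of which the values of that chart are arbitrary.\<close>

definition has_mderiv ::
  "('g, 'e::euclidean_space) lie_struct \<Rightarrow> ('g \<Rightarrow> 'b::real_normed_vector) \<Rightarrow> 'g \<Rightarrow> ('e \<Rightarrow> 'b) \<Rightarrow> bool" where
  "has_mderiv G f p D \<longleftrightarrow> ((f \<circ> chart_inv G p) has_derivative D) (at (chart G p p))"

definition has_tmap ::
  "('g::t2_space, 'e::euclidean_space) lie_struct \<Rightarrow> ('g \<Rightarrow> 'g) \<Rightarrow> 'g \<Rightarrow> ('e \<Rightarrow> 'e) \<Rightarrow> bool" where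
  "has_tmap G F p D \<longleftrightarrow> isCont F p \<and> has_mderiv G (chart G (F p) \<circ> F) p D"

lemma has_mderiv_imp_mderiv: "has_mderiv G f p D \<Longrightarrow> mderiv G f p = D"
  by (rule ext) (simp add: has_mderiv_def mderiv_def frechet_derivative_at[symmetric])

lemma has_tmap_imp_tmap: "has_tmap G F p D \<Longrightarrow> tmap G F p = D"
  unfolding has_tmap_def has_mderiv_def tmap_def[abs_def] by (metis frechet_derivative_at)

lemma has_mderiv_unique: "has_mderiv G f p D \<Longrightarrow> has_mderiv G f p E \<Longrightarrow> D = E"
  unfolding has_mderiv_def by (rule has_derivative_unique)

lemma has_mderiv_linear: "has_mderiv G f p D \<Longrightarrow> linear D"
  unfolding has_mderiv_def by (intro bounded_linear.linear has_derivative_bounded_linear)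

lemma has_tmap_linear: "has_tmap G F p D \<Longrightarrow> linear D"
  unfolding has_tmap_def by (auto dest: has_mderiv_linear)

lemma has_derivative_transform_nhds:
  assumes "(f has_derivative f') (at x)" "\<forall>\<^sub>F y in nhds x. f y = g y"
  shows "(g has_derivative f') (at x)"
  using assms by (auto simp: eventually_nhds intro: has_derivative_transform_within_open)

locale atlas =
  fixes G :: "('g::{t2_space,second_countable_topology}, 'e::euclidean_space) lie_struct"
  assumes manifold: "smooth_manifold G"
begin

lemma in_own_chart [simp]: "p \<in> chart_dom G p"
  and open_chart_dom: "open (chart_dom G p)"
  and open_chart_img: "open (chart_img G p)"
  and chart_homeomorphism: "homeomorphism (chart_dom G p) (chart_img G p) (chart G p) (chart_inv G p)"
  and smooth_on_transition: "smooth_on (chart G p ` (chart_dom G p \<inter> chart_dom G q)) (chart G q \<circ> chart_inv G p)"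
  using manifold by (auto simp: smooth_manifold_def)

lemma chart_inv_chart [simp]: "q \<in> chart_dom G p \<Longrightarrow> chart_inv G p (chart G p q) = q"
  and chart_chart_inv [simp]: "x \<in> chart_img G p \<Longrightarrow> chart G p (chart_inv G p x) = x"
  and chart_inv_in_dom [simp]: "x \<in> chart_img G p \<Longrightarrow> chart_inv G p x \<in> chart_dom G p"
  and chart_in_img [simp]: "q \<in> chart_dom G p \<Longrightarrow> chart G p q \<in> chart_img G p"
  using chart_homeomorphism[of p] by (auto simp: homeomorphism_def)

lemma isCont_chart_inv: "x \<in> chart_img G p \<Longrightarrow> isCont (chart_inv G p) x"
  using chart_homeomorphism[of p] open_chart_dom[of p] open_chart_img[of p]
  by (auto simp: homeomorphism_def continuous_on_eq_continuous_at)

lemma eventually_chart_inv: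
  assumes "q \<in> chart_dom G p" "open U" "q \<in> U"
  shows "\<forall>\<^sub>F x in nhds (chart G p q). chart_inv G p x \<in> U"
proof -
  have "(chart_inv G p \<longlongrightarrow> q) (nhds (chart G p q))"
    using isCont_chart_inv[of "chart G p q" p] assms(1)
      tendsto_at_iff_tendsto_nhds[of "chart_inv G p" "chart G p q"]
    by (simp add: isCont_def)
  then show ?thesis using assms(2,3) by (rule topological_tendstoD)
qed

lemma eventually_chart_img: "q \<in> chart_dom G p \<Longrightarrow> \<forall>\<^sub>F x in nhds (chart G p q). x \<in> chart_img G p"
  by (simp add: eventually_nhds_in_open open_chart_img)

lemma has_derivative_transition:
  assumes "q \<in> chart_dom G a" "q \<in> chart_dom G b"
  shows "((chart G b \<circ> chart_inv G a) has_derivative coord_change G a b q) (at (chart G a q))"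
  using smooth_on_has_derivative[OF smooth_on_transition[of a b], of "chart G a q"] assms
  by (auto simp: coord_change_def[abs_def])

lemma linear_coord_change: "q \<in> chart_dom G a \<Longrightarrow> q \<in> chart_dom G b \<Longrightarrow> linear (coord_change G a b q)"
  by (intro bounded_linear.linear has_derivative_bounded_linear[OF has_derivative_transition])

lemma has_mderiv_chart: "q \<in> chart_dom G p \<Longrightarrow> has_mderiv G (chart G p) q (coord_change G q p q)"
  by (simp add: has_mderiv_def has_derivative_transition)

lemma has_mderiv_in_chart:
  assumes "has_mderiv G f q D" "q \<in> chart_dom G p"
  shows "((f \<circ> chart_inv G p) has_derivative D \<circ> coord_change G p q q) (at (chart G p q))"
proof -
  have "((f \<circ> chart_inv G q) \<circ> (chart G q \<circ> chart_inv G p) has_derivative D \<circ> coord_change G p q q)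
      (at (chart G p q))"
    using assms by (intro diff_chain_at has_derivative_transition) (auto simp: has_mderiv_def)
  then show ?thesis
  proof (rule has_derivative_transform_nhds)
    show "\<forall>\<^sub>F x in nhds (chart G p q).
        (f \<circ> chart_inv G q \<circ> (chart G q \<circ> chart_inv G p)) x = (f \<circ> chart_inv G p) x"
      using eventually_chart_inv[OF assms(2) open_chart_dom[of q]] by (rule eventually_mono) auto
  qed
qed

lemma coord_change_self: "q \<in> chart_dom G a \<Longrightarrow> coord_change G a a q = (\<lambda>u. u)"
proof -
  assume q: "q \<in> chart_dom G a"
  have "((\<lambda>x. x) has_derivative (\<lambda>u. u)) (at (chart G a q))" by simp
  then have "((chart G a \<circ> chart_inv G a) has_derivative (\<lambda>u. u)) (at (chart G a q))"
    by (rule has_derivative_transform_nhds)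
       (use eventually_chart_img[OF q] in \<open>auto elim: eventually_mono\<close>)
  then show ?thesis using has_derivative_transition[OF q q] has_derivative_unique by blast
qed

lemma coord_change_comp:
  assumes "q \<in> chart_dom G a" "q \<in> chart_dom G b" "q \<in> chart_dom G c"
  shows "coord_change G b c q (coord_change G a b q u) = coord_change G a c q u"
proof -
  have "((chart G c \<circ> chart_inv G b) \<circ> (chart G b \<circ> chart_inv G a) has_derivative
      coord_change G b c q \<circ> coord_change G a b q) (at (chart G a q))"
    using assms by (intro diff_chain_at) (auto intro: has_derivative_transition)
  then have "((chart G c \<circ> chart_inv G a) has_derivative coord_change G b c q \<circ> coord_change G a b q)
      (at (chart G a q))"
  proof (rule has_derivative_transform_nhds)
    show "\<forall>\<^sub>F x in nhds (chart G a q).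
        (chart G c \<circ> chart_inv G b \<circ> (chart G b \<circ> chart_inv G a)) x = (chart G c \<circ> chart_inv G a) x"
      using eventually_chart_inv[OF assms(1) open_chart_dom[of b] assms(2)] by (rule eventually_mono) auto
  qed
  then have "coord_change G b c q \<circ> coord_change G a b q = coord_change G a c q"
    using has_derivative_transition[OF assms(1,3)] has_derivative_unique by blast
  then show ?thesis by (metis comp_apply)
qed

text \<open>Chain rule: near \<open>p\<close> the composition passes through the chart around \<open>F p\<close>.\<close>

lemma has_mderiv_compose:
  assumes "has_tmap G F p D" "has_mderiv G f (F p) E"
  shows "has_mderiv G (f \<circ> F) p (E \<circ> D)"
proof -
  have "((f \<circ> chart_inv G (F p)) \<circ> (chart G (F p) \<circ> F \<circ> chart_inv G p) has_derivative E \<circ> D)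
      (at (chart G p p))"
    using assms by (intro diff_chain_at) (auto simp: has_mderiv_def has_tmap_def)
  then show ?thesis unfolding has_mderiv_def
  proof (rule has_derivative_transform_nhds)
    have "\<forall>\<^sub>F q in nhds p. F q \<in> chart_dom G (F p)"
      using assms(1) open_chart_dom[of "F p"] unfolding has_tmap_def
      by (auto simp: isCont_def tendsto_at_iff_tendsto_nhds intro: topological_tendstoD)
    then obtain U where "open U" "p \<in> U" "\<And>q. q \<in> U \<Longrightarrow> F q \<in> chart_dom G (F p)"
      by (auto simp: eventually_nhds)
    then show "\<forall>\<^sub>F x in nhds (chart G p p).
        (f \<circ> chart_inv G (F p) \<circ> (chart G (F p) \<circ> F \<circ> chart_inv G p)) x = (f \<circ> F \<circ> chart_inv G p) x"
      using eventually_chart_inv[OF in_own_chart \<open>open U\<close> \<open>p \<in> U\<close>] by (auto elim: eventually_mono)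
  qed
qed

lemma has_tmap_compose:
  assumes "has_tmap G F p D" "has_tmap G H (F p) E"
  shows "has_tmap G (H \<circ> F) p (E \<circ> D)"
  using assms has_mderiv_compose[OF assms(1), of "chart G (H (F p)) \<circ> H" E]
  by (auto simp: has_tmap_def comp_def intro: isCont_o2)

lemma has_tmap_ident: "has_tmap G (\<lambda>h. h) p (\<lambda>u. u)"
  using has_mderiv_chart[of p p] by (simp add: has_tmap_def coord_change_self comp_def)

lemma smooth_fun_has_mderiv:
  "smooth_fun G f \<Longrightarrow> has_mderiv G f p (mderiv G f p)"
  unfolding has_mderiv_def mderiv_def[abs_def] smooth_fun_def
  by (rule smooth_on_has_derivative[of "chart_img G p"]) auto

end


section \<open>Translations and the adjoint action\<close>

locale lie =
  fixes G :: "('g::{t2_space,second_countable_topology}, 'e::euclidean_space) lie_struct" (structure)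
  assumes lie: "lie_group G"

sublocale lie \<subseteq> atlas G
  using lie by unfold_locales (simp add: lie_group_def)

sublocale lie \<subseteq> group G
  using lie by (simp add: lie_group_def)

context lie
begin

lemma carrier_UNIV [simp]: "carrier G = UNIV"
  using lie by (simp add: lie_group_def)

lemma inv_mult: "inv (g \<otimes> h) = inv h \<otimes> inv g"
  by (simp add: inv_mult_group)

lemma cancel [simp]:
  "inv g \<otimes> (g \<otimes> h) = h" "g \<otimes> (inv g \<otimes> h) = h" "inv g \<otimes> g = \<one>" "g \<otimes> inv g = \<one>"
  by (simp_all flip: m_assoc)

text \<open>The multiplication in charts, on the set where it is meaningful. All derivatives of
  translations are partial derivatives of this map, so their smooth dependence on the
  translating element is inherited from it.\<close>

definition mult_chart :: "'g \<Rightarrow> 'g \<Rightarrow> 'g \<Rightarrow> 'e \<times> 'e \<Rightarrow> 'e" where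
  "mult_chart p q k = (\<lambda>(x, y). chart G k (chart_inv G p x \<otimes> chart_inv G q y))"

definition mult_dom :: "'g \<Rightarrow> 'g \<Rightarrow> 'g \<Rightarrow> ('e \<times> 'e) set" where
  "mult_dom p q k = {(x, y). x \<in> chart_img G p \<and> y \<in> chart_img G q \<and>
                 chart_inv G p x \<otimes> chart_inv G q y \<in> chart_dom G k}"

abbreviation mult_deriv :: "'g \<Rightarrow> 'g \<Rightarrow> 'g \<Rightarrow> 'e \<times> 'e \<Rightarrow> 'e \<times> 'e \<Rightarrow> 'e" where
  "mult_deriv p q k z \<equiv> frechet_derivative (mult_chart p q k) (at z)"

lemma smooth_on_mult_chart: "smooth_on (mult_dom p q k) (mult_chart p q k)"
  using lie by (simp add: lie_group_def mult_dom_def mult_chart_def)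

lemma mult_has_derivative:
  "z \<in> mult_dom p q k \<Longrightarrow> (mult_chart p q k has_derivative mult_deriv p q k z) (at z)"
  by (rule smooth_on_has_derivative[OF smooth_on_mult_chart])

lemma mult_has_derivative_right:
  assumes "(x, y) \<in> mult_dom p q k"
  shows "((\<lambda>y. chart G k (chart_inv G p x \<otimes> chart_inv G q y)) has_derivative
      (\<lambda>u. mult_deriv p q k (x, y) (0, u))) (at y)"
proof -
  have "((\<lambda>y. (x, y)) has_derivative (\<lambda>u. (0, u))) (at y)"
    by (auto intro!: derivative_eq_intros)
  from has_derivative_compose[OF this mult_has_derivative[OF assms]]
  show ?thesis by (simp add: mult_chart_def)
qed

lemma mult_has_derivative_left:
  assumes "(x, y) \<in> mult_dom p q k"
  shows "((\<lambda>x. chart G k (chart_inv G p x \<otimes> chart_inv G q y)) has_derivative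
      (\<lambda>u. mult_deriv p q k (x, y) (u, 0))) (at x)"
proof -
  have "((\<lambda>x. (x, y)) has_derivative (\<lambda>u. (u, 0))) (at x)"
    by (auto intro!: derivative_eq_intros)
  from has_derivative_compose[OF this mult_has_derivative[OF assms]]
  show ?thesis by (simp add: mult_chart_def)
qed

lemma continuous_on_mult: "continuous_on UNIV (\<lambda>(g, h). g \<otimes> h)"
  and continuous_on_inv: "continuous_on UNIV (\<lambda>g. inv g)"
  using lie by (simp_all add: lie_group_def)

lemma isCont_left_mult: "isCont (\<lambda>h. g \<otimes> h) p"
proof -
  have "continuous_on UNIV (\<lambda>h. (g, h))" by (intro continuous_intros)
  from continuous_on_compose2[OF continuous_on_mult this]
  show ?thesis by (simp add: continuous_on_eq_continuous_at)
qed

lemma isCont_right_mult: "isCont (\<lambda>h. h \<otimes> g) p"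
proof -
  have "continuous_on UNIV (\<lambda>h. (h, g))" by (intro continuous_intros)
  from continuous_on_compose2[OF continuous_on_mult this]
  show ?thesis by (simp add: continuous_on_eq_continuous_at)
qed

abbreviation TL :: "'g \<Rightarrow> 'g \<Rightarrow> 'e \<Rightarrow> 'e" where "TL g \<equiv> tmap G (\<lambda>h. g \<otimes> h)"
abbreviation TR :: "'g \<Rightarrow> 'g \<Rightarrow> 'e \<Rightarrow> 'e" where "TR g \<equiv> tmap G (\<lambda>h. h \<otimes> g)"

lemma has_tmap_TL: "has_tmap G (\<lambda>h. g \<otimes> h) p (TL g p)"
proof -
  have "(chart G g g, chart G p p) \<in> mult_dom g p (g \<otimes> p)" by (simp add: mult_dom_def)
  then have "has_tmap G (\<lambda>h. g \<otimes> h) p (\<lambda>u. mult_deriv g p (g \<otimes> p) (chart G g g, chart G p p) (0, u))"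
    using mult_has_derivative_right isCont_left_mult
    by (fastforce simp: has_tmap_def has_mderiv_def comp_def)
  then show ?thesis using has_tmap_imp_tmap by metis
qed

lemma has_tmap_TR: "has_tmap G (\<lambda>h. h \<otimes> g) p (TR g p)"
proof -
  have "(chart G p p, chart G g g) \<in> mult_dom p g (p \<otimes> g)" by (simp add: mult_dom_def)
  then have "has_tmap G (\<lambda>h. h \<otimes> g) p (\<lambda>u. mult_deriv p g (p \<otimes> g) (chart G p p, chart G g g) (u, 0))"
    using mult_has_derivative_left isCont_right_mult
    by (fastforce simp: has_tmap_def has_mderiv_def comp_def)
  then show ?thesis using has_tmap_imp_tmap by metis
qed

lemma linear_TL: "linear (TL g p)" and linear_TR: "linear (TR g p)"
  using has_tmap_TL has_tmap_TR has_tmap_linear by blast+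

lemma TL_TL: "TL g (h \<otimes> p) (TL h p u) = TL (g \<otimes> h) p u"
  using has_tmap_imp_tmap[OF has_tmap_compose[OF has_tmap_TL[of h p] has_tmap_TL[of g "h \<otimes> p"]]]
  by (simp add: comp_def m_assoc)

lemma TR_TR: "TR g (p \<otimes> h) (TR h p u) = TR (h \<otimes> g) p u"
  using has_tmap_imp_tmap[OF has_tmap_compose[OF has_tmap_TR[of h p] has_tmap_TR[of g "p \<otimes> h"]]]
  by (simp add: comp_def m_assoc)

lemma TL_TR: "TL g (p \<otimes> h) (TR h p u) = TR h (g \<otimes> p) (TL g p u)"
  using has_tmap_imp_tmap[OF has_tmap_compose[OF has_tmap_TR[of h p] has_tmap_TL[of g "p \<otimes> h"]]]
    has_tmap_imp_tmap[OF has_tmap_compose[OF has_tmap_TL[of g p] has_tmap_TR[of h "g \<otimes> p"]]]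
  by (simp add: comp_def m_assoc) metis

lemma tmap_ident [simp]: "tmap G (\<lambda>h. h) p = (\<lambda>u. u)"
  by (rule has_tmap_imp_tmap[OF has_tmap_ident])

lemma ltrans_TL: "ltrans G g = TL g \<one>" and rtrans_TR: "rtrans G g = TR g \<one>"
  by (auto simp: ltrans_def rtrans_def)

lemma linear_ltrans: "linear (ltrans G g)" and linear_rtrans: "linear (rtrans G g)"
  by (simp_all add: ltrans_TL rtrans_TR linear_TL linear_TR)

lemma TL_ltrans: "TL g h (ltrans G h v) = ltrans G (g \<otimes> h) v"
  using TL_TL[of g h \<one>] by (simp add: ltrans_TL)

lemma TR_rtrans: "TR g h (rtrans G h v) = rtrans G (h \<otimes> g) v"
  using TR_TR[of g \<one> h] by (simp add: rtrans_TR)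

lemma TR_ltrans: "TR h g (ltrans G g v) = TL g h (rtrans G h v)"
  using TL_TR[of g \<one> h v] by (simp add: ltrans_TL rtrans_TR)

lemma ltrans_one [simp]: "ltrans G \<one> v = v" and rtrans_one [simp]: "rtrans G \<one> v = v"
  by (simp_all add: ltrans_TL rtrans_TR)

lemma ltrans_inverse [simp]: "TL (inv g) g (ltrans G g v) = v" "ltrans G g (TL (inv g) g u) = u"
  using TL_ltrans[of "inv g" g v] TL_TL[of g "inv g" g u] by (simp_all add: ltrans_TL)

lemma rtrans_inverse [simp]: "TR (inv g) g (rtrans G g v) = v" "rtrans G g (TR (inv g) g u) = u"
  using TR_rtrans[of "inv g" g v] TR_TR[of g g "inv g" u] by (simp_all add: rtrans_TR)

lemma Ad_eq: "Ad G g v = TR (inv g) g (ltrans G g v)"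
  using has_tmap_imp_tmap[OF has_tmap_compose[OF has_tmap_TL[of g \<one>] has_tmap_TR[of "inv g" "g \<otimes> \<one>"]]]
  by (simp add: Ad_def comp_def ltrans_TL)

lemma linear_Ad: "linear (Ad G g)"
  using linear_compose[OF linear_ltrans linear_TR] by (simp add: Ad_eq[abs_def] comp_def)

lemma rtrans_Ad: "rtrans G g (Ad G g v) = ltrans G g v"
  by (simp add: Ad_eq)

lemma Ad_one [simp]: "Ad G \<one> v = v"
  by (simp add: Ad_eq)

text \<open>Both sides agree after right translation by \<open>gh\<close>, because \<open>(Ad g v) g = g v\<close> and left and right
  translations commute.\<close>

lemma Ad_mult: "Ad G (g \<otimes> h) v = Ad G g (Ad G h v)"
proof -
  have "rtrans G (g \<otimes> h) (Ad G g (Ad G h v)) = TR h g (rtrans G g (Ad G g (Ad G h v)))"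
    by (simp add: TR_rtrans)
  also have "\<dots> = TL g h (rtrans G h (Ad G h v))" by (simp add: rtrans_Ad TR_ltrans)
  also have "\<dots> = rtrans G (g \<otimes> h) (Ad G (g \<otimes> h) v)" by (simp add: rtrans_Ad TL_ltrans)
  finally show ?thesis by (metis rtrans_inverse(1))
qed

lemma Ad_inverse [simp]: "Ad G (inv g) (Ad G g v) = v" "Ad G g (Ad G (inv g) v) = v"
  by (simp_all flip: Ad_mult)

text \<open>Left- and right-invariant vector fields in a chart, as partial derivatives of the
  multiplication.\<close>

lemma coord_change_ltrans:
  assumes "q \<in> chart_dom G p"
  shows "coord_change G q p q (ltrans G q w) = mult_deriv p \<one> p (chart G p q, chart G \<one> \<one>) (0, w)"
proof -
  have "has_mderiv G (chart G p \<circ> (\<lambda>h. q \<otimes> h)) \<one> (coord_change G q p q \<circ> TL q \<one>)"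
    by (rule has_mderiv_compose[OF has_tmap_TL]) (use assms in \<open>simp add: has_mderiv_chart\<close>)
  moreover have "has_mderiv G (chart G p \<circ> (\<lambda>h. q \<otimes> h)) \<one>
      (\<lambda>w. mult_deriv p \<one> p (chart G p q, chart G \<one> \<one>) (0, w))"
    using mult_has_derivative_right[of "chart G p q" "chart G \<one> \<one>" p \<one> p] assms
    by (simp add: mult_dom_def has_mderiv_def comp_def)
  ultimately have "coord_change G q p q \<circ> TL q \<one> = (\<lambda>w. mult_deriv p \<one> p (chart G p q, chart G \<one> \<one>) (0, w))"
    by (rule has_mderiv_unique)
  from fun_cong[OF this, of w] show ?thesis by (simp add: ltrans_TL)
qed

lemma coord_change_rtrans:
  assumes "q \<in> chart_dom G p"
  shows "coord_change G q p q (rtrans G q w) = mult_deriv \<one> p p (chart G \<one> \<one>, chart G p q) (w, 0)"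
proof -
  have "has_mderiv G (chart G p \<circ> (\<lambda>h. h \<otimes> q)) \<one> (coord_change G q p q \<circ> TR q \<one>)"
    by (rule has_mderiv_compose[OF has_tmap_TR]) (use assms in \<open>simp add: has_mderiv_chart\<close>)
  moreover have "has_mderiv G (chart G p \<circ> (\<lambda>h. h \<otimes> q)) \<one>
      (\<lambda>w. mult_deriv \<one> p p (chart G \<one> \<one>, chart G p q) (w, 0))"
    using mult_has_derivative_left[of "chart G \<one> \<one>" "chart G p q" \<one> p p] assms
    by (simp add: mult_dom_def has_mderiv_def comp_def)
  ultimately have "coord_change G q p q \<circ> TR q \<one> = (\<lambda>w. mult_deriv \<one> p p (chart G \<one> \<one>, chart G p q) (w, 0))"
    by (rule has_mderiv_unique)
  from fun_cong[OF this, of w] show ?thesis by (simp add: rtrans_TR)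
qed

definition inv_chart :: "'e \<Rightarrow> 'e" where
  "inv_chart x = chart G \<one> (inv (chart_inv G \<one> x))"

definition inv_dom :: "'e set" where
  "inv_dom = {x \<in> chart_img G \<one>. inv (chart_inv G \<one> x) \<in> chart_dom G \<one>}"

lemma smooth_on_inv_chart: "smooth_on inv_dom inv_chart"
  using lie by (simp add: lie_group_def inv_dom_def inv_chart_def[abs_def])

lemma one_in_inv_dom: "chart G \<one> \<one> \<in> inv_dom" and inv_chart_one: "inv_chart (chart G \<one> \<one>) = chart G \<one> \<one>"
  by (simp_all add: inv_dom_def inv_chart_def)

lemma eventually_inv_dom: "\<forall>\<^sub>F x in nhds (chart G \<one> \<one>). x \<in> inv_dom"
  using smooth_on_openD[OF smooth_on_inv_chart] one_in_inv_dom by (rule eventually_nhds_in_open)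

lemma has_tmap_inv: "\<exists>J. has_tmap G (\<lambda>h. inv h) \<one> J"
  using smooth_on_has_derivative[OF smooth_on_inv_chart one_in_inv_dom] continuous_on_inv
  by (auto simp: has_tmap_def has_mderiv_def comp_def inv_chart_def[abs_def] continuous_on_eq_continuous_at)

section \<open>The derivative of the adjoint action\<close>

text \<open>In the chart at the identity, right translation by \<open>q\<^sup>-\<^sup>1\<close> at \<open>q\<close> is a partial derivative
  of the multiplication at \<open>(q, q\<^sup>-\<^sup>1)\<close>; hence it depends differentiably on \<open>q\<close>.\<close>

abbreviation right_unit :: "'e \<Rightarrow> 'e \<Rightarrow> 'e" where
  "right_unit x u \<equiv> mult_deriv \<one> \<one> \<one> (x, inv_chart x) (u, 0)"

lemma inv_dom_mult_dom: "x \<in> inv_dom \<Longrightarrow> (x, inv_chart x) \<in> mult_dom \<one> \<one> \<one>"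
  by (simp add: inv_dom_def inv_chart_def mult_dom_def)

lemma TR_inv_eq_right_unit:
  assumes "x \<in> inv_dom"
  defines "q \<equiv> chart_inv G \<one> x"
  shows "TR (inv q) q u = right_unit x (coord_change G q \<one> q u)"
proof -
  have q: "q \<in> chart_dom G \<one>" "inv q \<in> chart_dom G \<one>" "chart G \<one> q = x"
    using assms by (auto simp: inv_dom_def)
  have "has_mderiv G (chart G \<one> \<circ> (\<lambda>h. h \<otimes> inv q)) q (TR (inv q) q)"
    using has_tmap_TR[of "inv q" q] by (simp add: has_tmap_def)
  from has_mderiv_in_chart[OF this q(1)]
  have "((\<lambda>y. chart G \<one> (chart_inv G \<one> y \<otimes> inv q)) has_derivative TR (inv q) q \<circ> coord_change G \<one> q q) (at x)"
    by (simp add: comp_def q)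
  moreover have "((\<lambda>y. chart G \<one> (chart_inv G \<one> y \<otimes> inv q)) has_derivative right_unit x) (at x)"
    using mult_has_derivative_left[OF inv_dom_mult_dom[OF assms(1)]] q
    by (simp add: inv_chart_def flip: q_def)
  ultimately have "TR (inv q) q \<circ> coord_change G \<one> q q = right_unit x"
    by (rule has_derivative_unique)
  then have "TR (inv q) q (coord_change G \<one> q q w) = right_unit x w" for w
    by (metis comp_apply)
  from this[of "coord_change G q \<one> q u"] show ?thesis
    using q by (simp add: coord_change_comp coord_change_self)
qed

lemma linear_right_unit: "x \<in> inv_dom \<Longrightarrow> linear (right_unit x)"
  by (rule bounded_linear.linear[OF has_derivative_bounded_linear
        [OF mult_has_derivative_left[OF inv_dom_mult_dom]]])

lemma eventually_linear_right_unit: "\<forall>\<^sub>F x in nhds (chart G \<one> \<one>). linear (right_unit x)"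
  using eventually_inv_dom by (rule eventually_mono) (rule linear_right_unit)

lemma mult_deriv_has_derivative:
  "z \<in> mult_dom p q k \<Longrightarrow> ((\<lambda>z. mult_deriv p q k z u) has_derivative
      frechet_derivative (\<lambda>z. mult_deriv p q k z u) (at z)) (at z)"
  by (rule smooth_on_has_derivative[OF smooth_on_frechet_derivative[OF smooth_on_mult_chart]])

lemma inv_chart_pair_has_derivative:
  "((\<lambda>x. (x, inv_chart x)) has_derivative
      (\<lambda>v. (v, frechet_derivative inv_chart (at (chart G \<one> \<one>)) v))) (at (chart G \<one> \<one>))"
  by (rule has_derivative_Pair[OF has_derivative_ident
          smooth_on_has_derivative[OF smooth_on_inv_chart one_in_inv_dom]])

lemma right_unit_differentiable: "\<exists>D. ((\<lambda>x. right_unit x u) has_derivative D) (at (chart G \<one> \<one>))"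
  by (rule exI, rule has_derivative_compose[OF inv_chart_pair_has_derivative
      mult_deriv_has_derivative[OF inv_dom_mult_dom[OF one_in_inv_dom], of "(u, 0)"]])

lemma right_unit_one: "right_unit (chart G \<one> \<one>) u = u"
  using TR_inv_eq_right_unit[OF one_in_inv_dom] by (simp add: coord_change_self)

text \<open>The mixed second derivative of the multiplication at the identity; twice its skew part is the
  Lie bracket.\<close>

definition mult_second :: "'e \<Rightarrow> 'e \<Rightarrow> 'e" where
  "mult_second v w = frechet_derivative (\<lambda>z. mult_deriv \<one> \<one> \<one> z (0, w)) (at (chart G \<one> \<one>, chart G \<one> \<one>)) (v, 0)"

lemma one_in_mult_dom: "(chart G \<one> \<one>, chart G \<one> \<one>) \<in> mult_dom \<one> \<one> \<one>"
  by (simp add: mult_dom_def)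

lemma ltrans_in_chart_has_derivative:
  "((\<lambda>x. mult_deriv \<one> \<one> \<one> (x, chart G \<one> \<one>) (0, w)) has_derivative (\<lambda>v. mult_second v w)) (at (chart G \<one> \<one>))"
proof -
  let ?e = "chart G \<one> \<one>"
  let ?B = "\<lambda>z. mult_deriv \<one> \<one> \<one> z (0, w)"
  have "((\<lambda>x. (x, ?e)) has_derivative (\<lambda>v. (v, 0))) (at ?e)"
    by (auto intro!: derivative_eq_intros)
  moreover have "(?B has_derivative frechet_derivative ?B (at (?e, ?e))) (at (?e, ?e))"
    by (rule smooth_on_has_derivative
        [OF smooth_on_frechet_derivative[OF smooth_on_mult_chart] one_in_mult_dom])
  ultimately show ?thesis
    unfolding mult_second_def by (rule has_derivative_compose[where f = "\<lambda>x. (x, ?e)" and g = ?B])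
qed

text \<open>The symmetry of second derivatives allows the derivatives of left- and of right-invariant
  vector fields to be expressed by the same bilinear map, with the arguments in opposite order.\<close>

lemma rtrans_in_chart_has_derivative:
  "((\<lambda>x. mult_deriv \<one> \<one> \<one> (chart G \<one> \<one>, x) (w, 0)) has_derivative (\<lambda>v. mult_second w v)) (at (chart G \<one> \<one>))"
proof -
  let ?e = "chart G \<one> \<one>"
  let ?B = "\<lambda>z. mult_deriv \<one> \<one> \<one> z (w, 0)"
  have "((\<lambda>x. (?e, x)) has_derivative (\<lambda>v. (0, v))) (at ?e)"
    by (auto intro!: derivative_eq_intros)
  moreover have "(?B has_derivative frechet_derivative ?B (at (?e, ?e))) (at (?e, ?e))"
    by (rule smooth_on_has_derivative
        [OF smooth_on_frechet_derivative[OF smooth_on_mult_chart] one_in_mult_dom])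
  ultimately have "((\<lambda>x. ?B (?e, x)) has_derivative (\<lambda>v. frechet_derivative ?B (at (?e, ?e)) (0, v))) (at ?e)"
    by (rule has_derivative_compose[where f = "\<lambda>x. (?e, x)" and g = ?B])
  also have "(\<lambda>v. frechet_derivative ?B (at (?e, ?e)) (0, v)) = (\<lambda>v. mult_second w v)"
    unfolding mult_second_def
    by (rule ext) (rule smooth_on_second_derivative_symmetric[OF smooth_on_mult_chart one_in_mult_dom])
  finally show ?thesis .
qed

lemma lie_bracket_eq: "lie_bracket G v w = mult_second v w - mult_second w v"
proof -
  have "has_mderiv G (\<lambda>q. coord_change G q \<one> q (ltrans G q w)) \<one> (\<lambda>v. mult_second v w)" for w
    unfolding has_mderiv_def
  proof (rule has_derivative_transform_nhds[OF ltrans_in_chart_has_derivative])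
    show "\<forall>\<^sub>F x in nhds (chart G \<one> \<one>). mult_deriv \<one> \<one> \<one> (x, chart G \<one> \<one>) (0, w) =
        ((\<lambda>q. coord_change G q \<one> q (ltrans G q w)) \<circ> chart_inv G \<one>) x"
      using eventually_chart_img[OF in_own_chart] by (rule eventually_mono) (simp add: coord_change_ltrans)
  qed
  from this[THEN has_mderiv_imp_mderiv] show ?thesis
    by (simp add: lie_bracket_def vf_bracket_def)
qed

text \<open>Differentiating \<open>g w = (Ad g w) g\<close> at the identity: the left-hand side contributes
  \<open>\<partial>\<^sub>1 \<partial>\<^sub>2\<close> of the multiplication at \<open>(v, w)\<close>, the right-hand side the derivative of \<open>Ad\<close> and
  \<open>\<partial>\<^sub>1 \<partial>\<^sub>2\<close> at \<open>(w, v)\<close>, so the derivative of \<open>Ad\<close> is the bracket.\<close>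

lemma has_mderiv_Ad: "has_mderiv G (\<lambda>g. Ad G g w) \<one> (\<lambda>v. lie_bracket G v w)"
proof -
  let ?e = "chart G \<one> \<one>"
  define R where "R u = (SOME D. ((\<lambda>x. right_unit x u) has_derivative D) (at ?e))" for u
  have R: "((\<lambda>x. right_unit x u) has_derivative R u) (at ?e)" for u
    unfolding R_def by (rule someI_ex[OF right_unit_differentiable])
  have "\<exists>D. has_mderiv G (\<lambda>g. Ad G g w) \<one> D"
  proof -
    have "((\<lambda>x. right_unit x (mult_deriv \<one> \<one> \<one> (x, ?e) (0, w))) has_derivative
        (\<lambda>v. R (mult_deriv \<one> \<one> \<one> (?e, ?e) (0, w)) v + right_unit ?e (mult_second v w))) (at ?e)"
      by (rule has_derivative_apply_linear_family[OF R eventually_linear_right_unit ltrans_in_chart_has_derivative])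
    then have "(((\<lambda>g. Ad G g w) \<circ> chart_inv G \<one>) has_derivative
        (\<lambda>v. R (mult_deriv \<one> \<one> \<one> (?e, ?e) (0, w)) v + right_unit ?e (mult_second v w))) (at ?e)"
    proof (rule has_derivative_transform_nhds)
      show "\<forall>\<^sub>F x in nhds ?e. right_unit x (mult_deriv \<one> \<one> \<one> (x, ?e) (0, w)) = ((\<lambda>g. Ad G g w) \<circ> chart_inv G \<one>) x"
        using eventually_inv_dom
      proof (rule eventually_mono)
        fix x assume x: "x \<in> inv_dom"
        then have "x \<in> chart_img G \<one>" by (simp add: inv_dom_def)
        then have "coord_change G (chart_inv G \<one> x) \<one> (chart_inv G \<one> x) (ltrans G (chart_inv G \<one> x) w) =
            mult_deriv \<one> \<one> \<one> (x, ?e) (0, w)"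
          using coord_change_ltrans[of "chart_inv G \<one> x" \<one> w] by simp
        then show "right_unit x (mult_deriv \<one> \<one> \<one> (x, ?e) (0, w)) = ((\<lambda>g. Ad G g w) \<circ> chart_inv G \<one>) x"
          using TR_inv_eq_right_unit[OF x] by (simp only: Ad_eq comp_apply)
      qed
    qed
    then show ?thesis unfolding has_mderiv_def by - (rule exI)
  qed
  then obtain D where D: "has_mderiv G (\<lambda>g. Ad G g w) \<one> D" by blast
  have lin: "linear (\<lambda>u. mult_deriv \<one> \<one> \<one> (?e, x) (u, 0))" if "x \<in> chart_img G \<one>" for x
  proof -
    have "(?e, x) \<in> mult_dom \<one> \<one> \<one>" using that by (simp add: mult_dom_def)
    from has_derivative_bounded_linear[OF mult_has_derivative_left[OF this]]
    show ?thesis by (rule bounded_linear.linear)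
  qed
  have "((\<lambda>x. mult_deriv \<one> \<one> \<one> (?e, x) (Ad G (chart_inv G \<one> x) w, 0)) has_derivative
      (\<lambda>v. mult_second (Ad G (chart_inv G \<one> ?e) w) v + mult_deriv \<one> \<one> \<one> (?e, ?e) (D v, 0))) (at ?e)"
  proof (rule has_derivative_apply_linear_family[where A = "\<lambda>x u. mult_deriv \<one> \<one> \<one> (?e, x) (u, 0)"
        and A' = mult_second and u = "\<lambda>x. Ad G (chart_inv G \<one> x) w" and u' = D])
    show "\<forall>\<^sub>F x in nhds ?e. linear (\<lambda>u. mult_deriv \<one> \<one> \<one> (?e, x) (u, 0))"
      using eventually_chart_img[OF in_own_chart] by (rule eventually_mono) (rule lin)
    show "((\<lambda>x. mult_deriv \<one> \<one> \<one> (?e, x) (u, 0)) has_derivative mult_second u) (at ?e)" for u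
      using rtrans_in_chart_has_derivative[of u] by simp
    show "((\<lambda>x. Ad G (chart_inv G \<one> x) w) has_derivative D) (at ?e)"
      using D by (simp add: has_mderiv_def comp_def)
  qed
  then have "((\<lambda>x. mult_deriv \<one> \<one> \<one> (x, ?e) (0, w)) has_derivative
      (\<lambda>v. mult_second w v + D v)) (at ?e)"
  proof (rule has_derivative_transform_nhds[THEN has_derivative_eq_rhs])
    show "\<forall>\<^sub>F x in nhds ?e. mult_deriv \<one> \<one> \<one> (?e, x) (Ad G (chart_inv G \<one> x) w, 0) =
        mult_deriv \<one> \<one> \<one> (x, ?e) (0, w)"
      using eventually_chart_img[OF in_own_chart]
    proof (rule eventually_mono)
      fix x assume "x \<in> chart_img G \<one>"
      then show "mult_deriv \<one> \<one> \<one> (?e, x) (Ad G (chart_inv G \<one> x) w, 0) = mult_deriv \<one> \<one> \<one> (x, ?e) (0, w)"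
        using coord_change_rtrans[of "chart_inv G \<one> x" \<one> "Ad G (chart_inv G \<one> x) w"]
          coord_change_ltrans[of "chart_inv G \<one> x" \<one> w]
        by (simp add: rtrans_Ad)
    qed
    have "mult_deriv \<one> \<one> \<one> (?e, ?e) (u, 0) = u" for u
      using right_unit_one by (simp add: inv_chart_one)
    then show "(\<lambda>v. mult_second (Ad G (chart_inv G \<one> ?e) w) v + mult_deriv \<one> \<one> \<one> (?e, ?e) (D v, 0)) =
        (\<lambda>v. mult_second w v + D v)"
      by simp
  qed
  from fun_cong[OF has_derivative_unique[OF this ltrans_in_chart_has_derivative]]
  have "mult_second w v + D v = mult_second v w" for v .
  then have "D = (\<lambda>v. lie_bracket G v w)"
    unfolding lie_bracket_eq by (metis add_diff_cancel_left')
  then show ?thesis using D by simp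
qed

lemma lie_bracket_antisym: "lie_bracket G v w = - lie_bracket G w v"
  by (simp add: lie_bracket_eq)

lemma linear_lie_bracket_left: "linear (\<lambda>v. lie_bracket G v w)"
  by (rule has_mderiv_linear[OF has_mderiv_Ad])

lemma linear_lie_bracket_right: "linear (lie_bracket G v)"
proof -
  have "lie_bracket G v = (\<lambda>w. - lie_bracket G w v)"
    by (simp add: fun_eq_iff lie_bracket_eq)
  then show ?thesis by (simp add: linear_compose_neg linear_lie_bracket_left)
qed

text \<open>Differentiating \<open>Ad g (Ad g\<^sup>-\<^sup>1 w) = w\<close> gives the derivative of the second factor without
  computing the tangent map of the inversion.\<close>

lemma has_mderiv_Ad_inv: "has_mderiv G (\<lambda>g. Ad G (inv g) w) \<one> (\<lambda>v. lie_bracket G w v)"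
proof -
  let ?e = "chart G \<one> \<one>"
  obtain J where J: "has_tmap G (\<lambda>h. inv h) \<one> J" using has_tmap_inv by blast
  have D: "has_mderiv G (\<lambda>g. Ad G (inv g) w) \<one> (\<lambda>v. lie_bracket G (J v) w)"
    using has_mderiv_compose[OF J, of "\<lambda>g. Ad G g w"] has_mderiv_Ad[of w] by (simp add: comp_def)
  have "((\<lambda>x. Ad G (chart_inv G \<one> x) (Ad G (inv (chart_inv G \<one> x)) w)) has_derivative
      (\<lambda>v. lie_bracket G v (Ad G (inv (chart_inv G \<one> ?e)) w) + Ad G (chart_inv G \<one> ?e) (lie_bracket G (J v) w))) (at ?e)"
  proof (rule has_derivative_apply_linear_family[where A = "\<lambda>x. Ad G (chart_inv G \<one> x)"
        and A' = "\<lambda>u v. lie_bracket G v u"])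
    show "((\<lambda>x. Ad G (chart_inv G \<one> x) u) has_derivative (\<lambda>v. lie_bracket G v u)) (at ?e)" for u
      using has_mderiv_Ad[of u] by (simp add: has_mderiv_def comp_def)
    show "((\<lambda>x. Ad G (inv (chart_inv G \<one> x)) w) has_derivative (\<lambda>v. lie_bracket G (J v) w)) (at ?e)"
      using D by (simp add: has_mderiv_def comp_def)
  qed (simp add: linear_Ad)
  then have "((\<lambda>x. w) has_derivative (\<lambda>v. lie_bracket G v w + lie_bracket G (J v) w)) (at ?e)"
    by simp
  then have "lie_bracket G v w + lie_bracket G (J v) w = 0" for v
    using fun_cong[OF has_derivative_unique[OF _ has_derivative_const[of w]]] by blast
  then have "lie_bracket G (J v) w = lie_bracket G w v" for v
    using lie_bracket_antisym[of w v] by (metis add_eq_0_iff)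
  then show ?thesis using D by simp
qed

lemma Ad_star_eq: "Ad_star G g = pullback (Ad G (inv g))"
  by (simp add: Ad_star_def pullback_def fun_eq_iff)

lemma ad_star_eq: "ad_star G v = pullback (\<lambda>w. lie_bracket G w v)"
  by (simp add: ad_star_def pullback_def fun_eq_iff)

lemma Ad_star_apply: "Ad_star G g \<phi> v = \<phi> (Ad G (inv g) v)"
  by (simp add: Ad_star_eq pullback_apply linear_Ad)

lemma ad_star_apply: "ad_star G v \<phi> w = \<phi> (lie_bracket G w v)"
  by (simp add: ad_star_eq pullback_apply linear_lie_bracket_left)

lemma linear_Ad_star: "linear (Ad_star G g)"
  by (simp add: Ad_star_eq linear_pullback linear_Ad)

lemma Ad_star_one [simp]: "Ad_star G \<one> \<phi> = \<phi>"
  by (rule blinfun_eqI) (simp add: Ad_star_apply)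

lemma Ad_star_mult: "Ad_star G (g \<otimes> h) \<phi> = Ad_star G g (Ad_star G h \<phi>)"
  by (rule blinfun_eqI) (simp add: Ad_star_apply inv_mult Ad_mult)

lemma Ad_star_inverse [simp]: "Ad_star G (inv g) (Ad_star G g \<phi>) = \<phi>" "Ad_star G g (Ad_star G (inv g) \<phi>) = \<phi>"
  by (simp_all flip: Ad_star_mult)

lemma has_mderiv_covec:
  fixes F :: "'g \<Rightarrow> 'e covec" and D :: "'e \<Rightarrow> 'e covec"
  shows "(\<And>v. has_mderiv G (\<lambda>g. F g v) p (\<lambda>h. D h v)) \<Longrightarrow> has_mderiv G F p D"
  unfolding has_mderiv_def by (rule has_derivative_covec) (simp add: comp_def)

lemma has_mderiv_covec_const:
  fixes \<phi> :: "'e covec"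
  shows "has_mderiv G F p D \<Longrightarrow> has_mderiv G (\<lambda>g. \<phi> (F g)) p (\<lambda>h. \<phi> (D h))"
  unfolding has_mderiv_def comp_def
  by (rule bounded_linear.has_derivative[OF blinfun.bounded_linear_right])

text \<open>The derivative at a general point, by writing \<open>h = g (g\<^sup>-\<^sup>1 h)\<close>.\<close>

lemma has_mderiv_Ad_inv_at:
  "has_mderiv G (\<lambda>h. Ad G (inv h) w) g (\<lambda>u. lie_bracket G (Ad G (inv g) w) (TL (inv g) g u))"
proof -
  have "has_mderiv G ((\<lambda>h. Ad G (inv h) (Ad G (inv g) w)) \<circ> (\<lambda>h. inv g \<otimes> h)) g
      ((\<lambda>v. lie_bracket G (Ad G (inv g) w) v) \<circ> TL (inv g) g)"
    using has_mderiv_Ad_inv[of "Ad G (inv g) w"] by (intro has_mderiv_compose[OF has_tmap_TL]) simp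
  moreover have "Ad G (inv (inv g \<otimes> h)) (Ad G (inv g) w) = Ad G (inv h) w" for h
    by (simp add: inv_mult Ad_mult)
  ultimately show ?thesis by (simp only: comp_def)
qed

end

context atlas begin

section \<open>Functions and forms with prescribed values at a point\<close>

text \<open>A quantity that is smooth in the chart around \<open>p\<close>, multiplied by a bump function in that
  chart and extended by zero, is smooth in every chart: the support is the image of a closed
  ball, hence compact and therefore closed, because the manifold is a Hausdorff space.\<close>

lemma smooth_on_cutoff:
  fixes h :: "'e \<Rightarrow> 'b::real_normed_vector"
  assumes R: "R > 0" "cball (chart G p p) R \<subseteq> chart_img G p"
    and h: "smooth_on (chart G q ` (chart_dom G q \<inter> chart_dom G p)) h"
  shows "smooth_on (chart_img G q) (\<lambda>x. if chart_inv G q x \<in> chart_dom G p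
    then bump (chart G p p) R (chart G p (chart_inv G q x)) *\<^sub>R h x else 0)" (is "smooth_on _ ?f")
proof -
  let ?c = "chart G p p"
  define K where "K = chart_inv G p ` cball ?c R"
  define S1 where "S1 = chart G q ` (chart_dom G q \<inter> chart_dom G p)"
  define S2 where "S2 = chart_img G q \<inter> chart_inv G q -` (- K)"
  have cont: "continuous_on (chart_img G a) (chart_inv G a)" for a
    using chart_homeomorphism by (auto simp: homeomorphism_def)
  have "compact K"
    unfolding K_def using R by (intro compact_continuous_image continuous_on_subset[OF cont]) auto
  then have "open (- K)" using compact_imp_closed by blast
  then have "open S2"
    unfolding S2_def by (intro continuous_open_preimage cont open_chart_img)
  have "smooth_on S1 ?f"
  proof (rule smooth_on_cong)
    have "smooth_on S1 (\<lambda>x. bump ?c R ((chart G p \<circ> chart_inv G q) x))"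
      using smooth_on_compose[OF smooth_on_transition[of q p] smooth_on_bump] by (simp add: S1_def)
    then show "smooth_on S1 (\<lambda>x. bump ?c R ((chart G p \<circ> chart_inv G q) x) *\<^sub>R h x)"
      using h unfolding S1_def by (intro smooth_on_bounded_bilinear[OF bounded_bilinear_scaleR])
  qed (auto simp: S1_def)
  moreover have "smooth_on S2 ?f"
  proof (rule smooth_on_cong[OF smooth_on_const[OF \<open>open S2\<close>, of 0]])
    fix x assume x: "x \<in> S2"
    show "0 = ?f x"
    proof (cases "chart_inv G q x \<in> chart_dom G p")
      case True
      have "chart G p (chart_inv G q x) \<notin> cball ?c R"
        using x True unfolding S2_def K_def by (metis ComplD IntD2 chart_inv_chart image_eqI vimageD)
      then show ?thesis by (simp add: bump_outside[OF R(1)])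
    qed simp
  qed
  ultimately have "smooth_on (S1 \<union> S2) ?f" by (rule smooth_on_Un)
  moreover have "S1 \<union> S2 = chart_img G q"
  proof
    show "S1 \<union> S2 \<subseteq> chart_img G q" by (auto simp: S1_def S2_def)
    show "chart_img G q \<subseteq> S1 \<union> S2"
    proof
      fix x assume x: "x \<in> chart_img G q"
      show "x \<in> S1 \<union> S2"
      proof (cases "chart_inv G q x \<in> K")
        case True
        then have "chart_inv G q x \<in> chart_dom G p" using R by (auto simp: K_def)
        then have "x \<in> S1" unfolding S1_def using x by (metis IntI chart_chart_inv chart_inv_in_dom image_eqI)
        then show ?thesis by simp
      qed (use x in \<open>auto simp: S2_def\<close>)
    qed
  qed
  ultimately show ?thesis by simp
qed

lemma chart_contains_cball:
  obtains R where "R > 0" "cball (chart G p p) R \<subseteq> chart_img G p"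
  using open_contains_cball[of "chart_img G p"] open_chart_img in_own_chart chart_in_img by meson

text \<open>A linear functional in the chart around \<open>p\<close>, vanishing at \<open>p\<close> and cut off: the derivative of
  the cut-off factor does not contribute at \<open>p\<close>.\<close>

lemma exists_smooth_fun_with_mderiv:
  fixes \<phi> :: "'e covec"
  obtains a :: "'g \<Rightarrow> real" where "smooth_fun G a" "mderiv G a p = \<phi>"
proof -
  let ?c = "chart G p p"
  obtain R where R: "R > 0" "cball ?c R \<subseteq> chart_img G p" by (rule chart_contains_cball)
  define a where "a q = (if q \<in> chart_dom G p then bump ?c R (chart G p q) *\<^sub>R \<phi> (chart G p q - ?c) else 0)" for q
  have "smooth_on (chart_img G q) (a \<circ> chart_inv G q)" for q
  proof -
    let ?S = "chart G q ` (chart_dom G q \<inter> chart_dom G p)"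
    have "smooth_on ?S (\<lambda>x. (chart G p \<circ> chart_inv G q) x + (- ?c))"
      using smooth_on_transition[of q p] by (intro smooth_on_add smooth_on_const smooth_on_openD)
    from smooth_on_bounded_linear[OF blinfun.bounded_linear_right this]
    have "smooth_on ?S (\<lambda>x. \<phi> ((chart G p \<circ> chart_inv G q) x - ?c))" by simp
    from smooth_on_cutoff[OF R this] show ?thesis
      unfolding a_def[abs_def] comp_def .
  qed
  then have "smooth_fun G a" by (simp add: smooth_fun_def)
  moreover have "mderiv G a p = \<phi>"
  proof -
    have b: "(bump ?c R has_derivative frechet_derivative (bump ?c R) (at ?c)) (at ?c)"
      by (rule smooth_on_has_derivative[OF smooth_on_bump]) simp
    have "((\<lambda>x. \<phi> (x - ?c)) has_derivative (\<lambda>u. \<phi> u)) (at ?c)"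
      by (rule has_derivative_eq_rhs[OF bounded_linear.has_derivative[OF blinfun.bounded_linear_right]])
         (auto intro!: derivative_eq_intros)
    from has_derivative_scaleR[OF b this]
    have "((\<lambda>x. bump ?c R x *\<^sub>R \<phi> (x - ?c)) has_derivative \<phi>) (at ?c)"
      by (simp add: bump_center[OF R(1)])
    then have "has_mderiv G a p \<phi>" unfolding has_mderiv_def
    proof (rule has_derivative_transform_nhds)
      show "\<forall>\<^sub>F x in nhds ?c. bump ?c R x *\<^sub>R \<phi> (x - ?c) = (a \<circ> chart_inv G p) x"
        using eventually_chart_img[OF in_own_chart] by (rule eventually_mono) (simp add: a_def)
    qed
    then show ?thesis by (rule has_mderiv_imp_mderiv)
  qed
  ultimately show thesis by (rule that)
qed

text \<open>A 1-form with constant components in the chart around \<open>p\<close>, cut off. In another chart its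
  components are derivatives of the transition map, and therefore smooth.\<close>

lemma exists_one_form_with_value:
  fixes \<psi> :: "'e covec"
  obtains \<tau> where "one_form G \<tau>" "\<tau> p = \<psi>"
proof -
  let ?c = "chart G p p"
  obtain R where R: "R > 0" "cball ?c R \<subseteq> chart_img G p" by (rule chart_contains_cball)
  define \<tau> where "\<tau> q = (if q \<in> chart_dom G p then bump ?c R (chart G p q) *\<^sub>R pullback (coord_change G q p q) \<psi> else 0)" for q
  have "smooth_on (chart_img G q) ((\<lambda>q'. Blinfun (\<lambda>v. \<tau> q' (coord_change G q q' q' v))) \<circ> chart_inv G q)" for q
  proof -
    let ?S = "chart G q ` (chart_dom G q \<inter> chart_dom G p)"
    let ?h = "\<lambda>x. pullback (coord_change G q p (chart_inv G q x)) \<psi>"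
    have "smooth_on ?S ?h"
    proof (rule smooth_on_cong)
      show "smooth_on ?S (\<lambda>x. \<Sum>b\<in>Basis. \<psi> (frechet_derivative (chart G p \<circ> chart_inv G q) (at x) b) *\<^sub>R
          (blinfun_inner_left b :: 'e covec))"
        by (intro smooth_on_sum smooth_on_bounded_linear[OF bounded_linear_scaleR_left]
              smooth_on_bounded_linear[OF blinfun.bounded_linear_right]
              smooth_on_frechet_derivative[OF smooth_on_transition] smooth_on_openD[OF smooth_on_transition])
      fix x assume "x \<in> ?S"
      then obtain q' where q': "q' \<in> chart_dom G q" "q' \<in> chart_dom G p" "x = chart G q q'" by auto
      then show "(\<Sum>b\<in>Basis. \<psi> (frechet_derivative (chart G p \<circ> chart_inv G q) (at x) b) *\<^sub>R
          blinfun_inner_left b) = ?h x"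
        by (subst covec_expand[of "?h x"])
           (simp add: pullback_apply linear_coord_change coord_change_def)
    qed
    from smooth_on_cutoff[OF R this] show ?thesis
    proof (rule smooth_on_cong)
      fix x assume x: "x \<in> chart_img G q"
      let ?q = "chart_inv G q x"
      show "(if ?q \<in> chart_dom G p then bump ?c R (chart G p ?q) *\<^sub>R ?h x else 0) =
          ((\<lambda>q'. Blinfun (\<lambda>v. \<tau> q' (coord_change G q q' q' v))) \<circ> chart_inv G q) x"
      proof (cases "?q \<in> chart_dom G p")
        case True
        have "Blinfun (\<lambda>v. \<tau> ?q (coord_change G q ?q ?q v)) = Blinfun (blinfun_apply (bump ?c R (chart G p ?q) *\<^sub>R ?h x))"
          using True x by (intro arg_cong[of _ _ Blinfun])
            (auto simp: fun_eq_iff \<tau>_def blinfun.scaleR_left pullback_apply linear_coord_change coord_change_comp)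
        then show ?thesis using True by (simp add: blinfun_apply_inverse)
      next
        case False
        have "Blinfun (blinfun_apply 0) = (0 :: 'e covec)" by (rule blinfun_apply_inverse)
        moreover have "(\<lambda>v. 0) = blinfun_apply (0 :: 'e covec)" by (simp add: fun_eq_iff)
        ultimately show ?thesis using False by (simp add: \<tau>_def)
      qed
    qed
  qed
  then have "one_form G \<tau>" by (simp add: one_form_def)
  moreover have "\<tau> p = \<psi>"
    by (simp add: \<tau>_def coord_change_self pullback_id bump_center[OF R(1)])
  ultimately show thesis by (rule that)
qed

end

context lie begin

section \<open>Trivialised forms and the Poisson bracket\<close>

lemma ltriv_apply: "ltriv G \<tau> g v = \<tau> g (ltrans G g v)"
  using pullback_apply[OF linear_ltrans, of g "\<tau> g" v] by (simp add: ltriv_def pullback_def)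

lemma linear_mderiv: "smooth_fun G a \<Longrightarrow> linear (mderiv G a g)"
  by (rule has_mderiv_linear[OF smooth_fun_has_mderiv])

lemma L_hat_apply: "smooth_fun G a \<Longrightarrow> L_hat G a g v = mderiv G a g (ltrans G g v)"
  using linear_compose[OF linear_ltrans linear_mderiv[of a g]]
  by (simp add: L_hat_def bounded_linear_Blinfun_apply comp_def linear_conv_bounded_linear)

lemma R_hat_apply: "smooth_fun G a \<Longrightarrow> R_hat G a g v = mderiv G a g (rtrans G g v)"
  using linear_compose[OF linear_rtrans linear_mderiv[of a g]]
  by (simp add: R_hat_def bounded_linear_Blinfun_apply comp_def linear_conv_bounded_linear)

lemma rtrans_eq_ltrans: "rtrans G g v = ltrans G g (Ad G (inv g) v)"
  using rtrans_Ad[of g "Ad G (inv g) v"] by simp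

lemma R_hat_eq_Ad_star_L_hat: "smooth_fun G a \<Longrightarrow> R_hat G a g = Ad_star G g (L_hat G a g)"
  by (rule blinfun_eqI) (simp add: R_hat_apply L_hat_apply Ad_star_apply rtrans_eq_ltrans)

lemma exists_smooth_fun_with_L_hat:
  obtains a where "smooth_fun G a" "L_hat G a g = \<phi>"
proof -
  obtain a where a: "smooth_fun G a" "mderiv G a g = pullback (TL (inv g) g) \<phi>"
    by (rule exists_smooth_fun_with_mderiv)
  then have "L_hat G a g = \<phi>"
    by (intro blinfun_eqI) (simp add: L_hat_apply pullback_apply linear_TL)
  then show thesis using a that by blast
qed

lemma exists_one_form_with_ltriv:
  obtains \<tau> where "one_form G \<tau>" "ltriv G \<tau> g = \<psi>"
proof -
  obtain \<tau> where \<tau>: "one_form G \<tau>" "\<tau> g = pullback (TL (inv g) g) \<psi>"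
    by (rule exists_one_form_with_value)
  then have "ltriv G \<tau> g = \<psi>"
    by (intro blinfun_eqI) (simp add: ltriv_apply pullback_apply linear_TL)
  then show thesis using \<tau> that by blast
qed

text \<open>In the chart around \<open>g\<close> the left trivialisation is a smooth covector applied to the smooth
  components of a left-invariant vector field.\<close>

lemma has_mderiv_ltriv:
  assumes "one_form G \<tau>"
  shows "has_mderiv G (ltriv G \<tau>) g (mderiv G (ltriv G \<tau>) g)"
proof -
  let ?e = "chart G \<one> \<one>"
  define T where "T q = Blinfun (\<lambda>v. \<tau> q (coord_change G g q q v))" for q
  have T: "T q v = \<tau> q (coord_change G g q q v)" if "q \<in> chart_dom G g" for q v
    using pullback_apply[OF linear_coord_change[of q g q], of "\<tau> q" v] that
    by (simp add: T_def pullback_def)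
  have "smooth_on (chart_img G g) (T \<circ> chart_inv G g)"
    using assms by (simp add: one_form_def T_def[abs_def])
  then have dT: "((\<lambda>x. T (chart_inv G g x)) has_derivative
      frechet_derivative (\<lambda>x. T (chart_inv G g x)) (at (chart G g g))) (at (chart G g g))"
    unfolding comp_def by (rule smooth_on_has_derivative) simp
  have "(chart G g g, ?e) \<in> mult_dom g \<one> g" by (simp add: mult_dom_def)
  note dm = mult_deriv_has_derivative[OF this]
  have dx: "((\<lambda>x. (x, ?e)) has_derivative (\<lambda>h. (h, 0))) (at (chart G g g))"
    by (auto intro!: derivative_eq_intros)
  have "(ltriv G \<tau> \<circ> chart_inv G g) differentiable (at (chart G g g))"
  proof (rule differentiable_covec)
    fix v
    note bounded_bilinear.FDERIV[OF bounded_bilinear_blinfun_apply dT has_derivative_compose[OF dx dm[of "(0, v)"]]]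
    then have "((\<lambda>x. (ltriv G \<tau> \<circ> chart_inv G g) x v) has_derivative
      (\<lambda>h. T (chart_inv G g (chart G g g)) (frechet_derivative (\<lambda>z. mult_deriv g \<one> g z (0, v)) (at (chart G g g, ?e)) (h, 0)) +
        frechet_derivative (\<lambda>x. T (chart_inv G g x)) (at (chart G g g)) h (mult_deriv g \<one> g (chart G g g, ?e) (0, v)))) (at (chart G g g))"
    proof (rule has_derivative_transform_nhds)
      show "\<forall>\<^sub>F x in nhds (chart G g g). T (chart_inv G g x) (mult_deriv g \<one> g (x, ?e) (0, v)) =
          (ltriv G \<tau> \<circ> chart_inv G g) x v"
        using eventually_chart_img[OF in_own_chart]
      proof (rule eventually_mono)
        fix x assume x: "x \<in> chart_img G g"
        let ?q = "chart_inv G g x"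
        have "T ?q (mult_deriv g \<one> g (x, ?e) (0, v)) = T ?q (coord_change G ?q g ?q (ltrans G ?q v))"
          using x by (simp add: coord_change_ltrans)
        then show "T ?q (mult_deriv g \<one> g (x, ?e) (0, v)) = (ltriv G \<tau> \<circ> chart_inv G g) x v"
          using x by (simp add: T coord_change_comp coord_change_self ltriv_apply)
      qed
    qed
    then show "(\<lambda>x. (ltriv G \<tau> \<circ> chart_inv G g) x v) differentiable (at (chart G g g))"
      by (rule differentiableI)
  qed
  then show ?thesis
    by (simp add: has_mderiv_def mderiv_def[abs_def] frechet_derivative_works[symmetric])
qed

text \<open>In the left trivialisation at \<open>g\<close>, differentiating the coadjoint factor of the right
  trivialisation produces the term \<open>ad\<^sup>*\<close>.\<close>

lemma has_mderiv_rtriv: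
  assumes "one_form G \<tau>"
  shows "has_mderiv G (rtriv G \<tau>) g (\<lambda>u. Ad_star G g
    (mderiv G (ltriv G \<tau>) g u + ad_star G (TL (inv g) g u) (ltriv G \<tau> g)))"
proof (rule has_mderiv_covec)
  fix v
  have "has_mderiv G (\<lambda>h. ltriv G \<tau> h (Ad G (inv h) v)) g
      (\<lambda>u. ltriv G \<tau> g (lie_bracket G (Ad G (inv g) v) (TL (inv g) g u)) +
        mderiv G (ltriv G \<tau>) g u (Ad G (inv g) v))"
    using bounded_bilinear.FDERIV[OF bounded_bilinear_blinfun_apply
        has_mderiv_ltriv[OF assms, of g, unfolded has_mderiv_def]
        has_mderiv_Ad_inv_at[of v g, unfolded has_mderiv_def]]
    by (simp add: has_mderiv_def comp_def)
  then show "has_mderiv G (\<lambda>h. rtriv G \<tau> h v) g (\<lambda>u. Ad_star G g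
      (mderiv G (ltriv G \<tau>) g u + ad_star G (TL (inv g) g u) (ltriv G \<tau> g)) v)"
    by (simp add: rtriv_def Ad_star_apply ad_star_apply blinfun.add_left add.commute)
qed

text \<open>Differentiate \<open>Ad (g h g\<^sup>-\<^sup>1) Ad g = Ad g Ad h\<close> in \<open>h\<close> at the identity.\<close>

lemma Ad_lie_bracket: "Ad G g (lie_bracket G v w) = lie_bracket G (Ad G g v) (Ad G g w)"
proof -
  have "has_tmap G ((\<lambda>h. h \<otimes> inv g) \<circ> (\<lambda>h. g \<otimes> h)) \<one> (TR (inv g) (g \<otimes> \<one>) \<circ> TL g \<one>)"
    by (rule has_tmap_compose[OF has_tmap_TL has_tmap_TR])
  then have c: "has_tmap G (\<lambda>h. g \<otimes> h \<otimes> inv g) \<one> (Ad G g)"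
    by (simp add: comp_def Ad_eq[abs_def] ltrans_TL)
  have "has_mderiv G ((\<lambda>h. Ad G h (Ad G g w)) \<circ> (\<lambda>h. g \<otimes> h \<otimes> inv g)) \<one>
      ((\<lambda>v. lie_bracket G v (Ad G g w)) \<circ> Ad G g)"
    by (rule has_mderiv_compose[OF c]) (use has_mderiv_Ad in simp)
  then have l: "has_mderiv G (\<lambda>h. Ad G g (Ad G h w)) \<one> (\<lambda>v. lie_bracket G (Ad G g v) (Ad G g w))"
    by (simp add: comp_def Ad_mult)
  have "has_mderiv G (\<lambda>h. Ad G g (Ad G h w)) \<one> (\<lambda>v. Ad G g (lie_bracket G v w))"
    using bounded_linear.has_derivative[OF linear_Ad[unfolded linear_conv_bounded_linear]
        has_mderiv_Ad[of w, unfolded has_mderiv_def]]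
    by (simp add: has_mderiv_def comp_def)
  from fun_cong[OF has_mderiv_unique[OF this l]] show ?thesis .
qed

lemma ad_star_Ad:
  "ad_star G (Ad G (inv g) y) \<psi> = Ad_star G (inv g) (ad_star G y (Ad_star G g \<psi>))"
  by (rule blinfun_eqI) (simp add: ad_star_apply Ad_star_apply Ad_lie_bracket)

text \<open>For \<open>t = r\<^sub>-\<close> this is the term \<open>K\<close> that separates \<open>\<Xi>\<close> from \<open>\<Xi>h\<close>.\<close>

definition ad_term :: "'e tens2 \<Rightarrow> 'e covec \<Rightarrow> 'e covec \<Rightarrow> 'e covec" where
  "ad_term t \<phi> \<psi> = contract (\<lambda>x y. \<phi> x *\<^sub>R ad_star G y \<psi>) t"

lemma linear_ad_star_left: "linear (\<lambda>y. ad_star G y \<psi>)"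
  by (auto intro!: linearI blinfun_eqI
      simp: ad_star_apply linear_add[OF linear_lie_bracket_right] linear_scale[OF linear_lie_bracket_right]
        blinfun.add_left blinfun.add_right blinfun.scaleR_left blinfun.scaleR_right)

text \<open>The difference of \<open>{a, Ad\<^sup>* s}\<close> and \<open>Ad\<^sup>* {a, s}\<close> for a bivector of the form
  \<open>g t - t g\<close>: the part \<open>g t\<close> contributes the correction term formed from the
  left-trivialised data and the part \<open>t g\<close> that formed from the right-trivialised data.\<close>

lemma pbracket_rtriv:
  assumes \<omega>: "\<omega> g = tens_map (ltrans G g) t - tens_map (rtrans G g) t"
    and a: "smooth_fun G a" and \<tau>: "one_form G \<tau>"
  shows "pbracket G \<omega> a (rtriv G \<tau>) g =
    Ad_star G g (pbracket G \<omega> a (ltriv G \<tau>) g + ad_term t (L_hat G a g) (ltriv G \<tau> g)) -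
    ad_term t (R_hat G a g) (rtriv G \<tau> g)"
proof -
  let ?s = "ltriv G \<tau>"
  let ?f = "\<lambda>u v. mderiv G a g u *\<^sub>R ad_star G (TL (inv g) g v) (?s g)"
  have bil: "bilinear ?f"
    using linear_mderiv[OF a, of g] linear_compose[OF linear_TL[of "inv g" g] linear_ad_star_left[of "?s g"]]
    by (auto simp: bilinear_def linear_iff comp_def algebra_simps)
  have "pbracket G \<omega> a (rtriv G \<tau>) g = contract (\<lambda>u v. Ad_star G g (mderiv G a g u *\<^sub>R mderiv G ?s g v + ?f u v)) (\<omega> g)"
    by (simp add: pbracket_def has_mderiv_imp_mderiv[OF has_mderiv_rtriv[OF \<tau>]]
        linear_add[OF linear_Ad_star] linear_scale[OF linear_Ad_star] scaleR_add_right)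
  also have "\<dots> = Ad_star G g (pbracket G \<omega> a ?s g + contract ?f (\<omega> g))"
    by (simp add: linear_contract_commute[OF linear_Ad_star, symmetric] contract_plus pbracket_def)
  also have "contract ?f (\<omega> g) = ad_term t (L_hat G a g) (?s g) -
      Ad_star G (inv g) (ad_term t (R_hat G a g) (rtriv G \<tau> g))"
  proof -
    have "contract ?f (tens_map (ltrans G g) t) = ad_term t (L_hat G a g) (?s g)"
      by (simp add: contract_tens_map[OF bil] ad_term_def L_hat_apply[OF a])
    moreover have "contract ?f (tens_map (rtrans G g) t) =
        contract (\<lambda>x y. R_hat G a g x *\<^sub>R ad_star G (Ad G (inv g) y) (?s g)) t"
      by (simp add: contract_tens_map[OF bil] R_hat_apply[OF a]) (simp add: rtrans_eq_ltrans)
    moreover have "\<dots> = Ad_star G (inv g) (ad_term t (R_hat G a g) (rtriv G \<tau> g))"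
      by (simp add: ad_term_def linear_contract_commute[OF linear_Ad_star] linear_scale[OF linear_Ad_star]
          ad_star_Ad rtriv_def)
    ultimately show ?thesis by (simp add: \<omega> contract_diff)
  qed
  finally show ?thesis
    by (simp add: linear_add[OF linear_Ad_star] linear_diff[OF linear_Ad_star])
qed

section \<open>The bivector of a quasitriangular Poisson--Lie group\<close>

lemma push_eq_tens_map: "push G F p = tens_map (tmap G F p)"
  by (simp add: push_def tens_map_def fun_eq_iff)

lemma coboundary_bivector_eq:
  "coboundary_bivector G r g = tens_map (ltrans G g) r - tens_map (rtrans G g) r"
  by (simp add: coboundary_bivector_def tens_map_def)

lemma skew_part_diff: "skew_part (s - t) = skew_part s - skew_part t"
  by (intro tens2_eqI) (simp add: skew_part_apply blinfun.diff_left field_simps)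

text \<open>The bivector equals its own skew part, and taking skew parts commutes with translations.\<close>

lemma skew_coboundary:
  assumes "\<And>\<phi> \<psi>. coboundary_bivector G r g \<phi> \<psi> = - coboundary_bivector G r g \<psi> \<phi>"
  shows "coboundary_bivector G r g = tens_map (ltrans G g) (skew_part r) - tens_map (rtrans G g) (skew_part r)"
proof -
  have "coboundary_bivector G r g = skew_part (coboundary_bivector G r g)"
  proof (rule tens2_eqI)
    fix \<phi> \<psi>
    show "coboundary_bivector G r g \<phi> \<psi> = skew_part (coboundary_bivector G r g) \<phi> \<psi>"
      using assms[of \<phi> \<psi>] by (simp add: skew_part_apply)
  qed
  then show ?thesis
    by (simp add: coboundary_bivector_eq skew_part_diff tens_map_skew_part linear_ltrans linear_rtrans)
qed


text \<open>In the chart at the identity the value at \<open>q\<close> of a smooth bivector is a smooth function, and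
  right translation by \<open>q\<^sup>-\<^sup>1\<close> is differentiable in \<open>q\<close>.\<close>

lemma has_mderiv_right_trivialised_bivector:
  assumes "smooth_bivector G \<omega>"
  shows "\<exists>D. has_mderiv G (\<lambda>g. tens_map (TR (inv g) g) (\<omega> g)) \<one> D"
proof -
  let ?e = "chart G \<one> \<one>"
  define W where "W q = tens_map (coord_change G q \<one> q) (\<omega> q)" for q
  have "smooth_on (chart_img G \<one>) (W \<circ> chart_inv G \<one>)"
    using assms by (simp add: smooth_bivector_def W_def[abs_def] tens_map_def)
  then have dW: "((\<lambda>x. W (chart_inv G \<one> x)) has_derivative
      frechet_derivative (\<lambda>x. W (chart_inv G \<one> x)) (at ?e)) (at ?e)"
    unfolding comp_def by (rule smooth_on_has_derivative) simp
  define R where "R u = (SOME D. ((\<lambda>x. right_unit x u) has_derivative D) (at ?e))" for u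
  have R: "((\<lambda>x. right_unit x u) has_derivative R u) (at ?e)" for u
    unfolding R_def by (rule someI_ex[OF right_unit_differentiable])
  note has_derivative_tens_map[where T = right_unit, OF R dW]
  then have "(((\<lambda>g. tens_map (TR (inv g) g) (\<omega> g)) \<circ> chart_inv G \<one>) has_derivative
      (\<lambda>h. contract (\<lambda>x y. tensor (R x h) (right_unit ?e y) + tensor (right_unit ?e x) (R y h)) (W (chart_inv G \<one> ?e)) +
        tens_map (right_unit ?e) (frechet_derivative (\<lambda>x. W (chart_inv G \<one> x)) (at ?e) h))) (at ?e)"
  proof (rule has_derivative_transform_nhds)
    show "\<forall>\<^sub>F x in nhds ?e. tens_map (right_unit x) (W (chart_inv G \<one> x)) =
        ((\<lambda>g. tens_map (TR (inv g) g) (\<omega> g)) \<circ> chart_inv G \<one>) x"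
      using eventually_inv_dom
    proof (rule eventually_mono)
      fix x assume x: "x \<in> inv_dom"
      let ?q = "chart_inv G \<one> x"
      have "?q \<in> chart_dom G \<one>" using x by (simp add: inv_dom_def)
      then have "tens_map (right_unit x) (W ?q) = tens_map (right_unit x \<circ> coord_change G ?q \<one> ?q) (\<omega> ?q)"
        unfolding W_def by (intro tens_map_tens_map linear_right_unit[OF x] linear_coord_change) simp_all
      also have "right_unit x \<circ> coord_change G ?q \<one> ?q = TR (inv ?q) ?q"
        by (simp add: fun_eq_iff TR_inv_eq_right_unit[OF x])
      finally show "tens_map (right_unit x) (W ?q) = ((\<lambda>g. tens_map (TR (inv g) g) (\<omega> g)) \<circ> chart_inv G \<one>) x"
        by simp
    qed
  qed
  then show ?thesis unfolding has_mderiv_def by - (rule exI)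
qed

text \<open>The right-trivialised bivector \<open>g r g\<^sup>-\<^sup>1 - r\<close> has cobracket \<open>v \<mapsto> ad v r\<close>.\<close>

lemma has_mderiv_tens_map_Ad: "has_mderiv G (\<lambda>g. tens_map (Ad G g) r) \<one> (\<lambda>v. ad_tens G v r)"
proof -
  let ?e = "chart G \<one> \<one>"
  have T: "((\<lambda>x. Ad G (chart_inv G \<one> x) w) has_derivative (\<lambda>v. lie_bracket G v w)) (at ?e)" for w
    using has_mderiv_Ad[of w] by (simp add: has_mderiv_def comp_def)
  note has_derivative_tens_map[where T = "\<lambda>x. Ad G (chart_inv G \<one> x)", OF T has_derivative_const[of r]]
  then show ?thesis
    by (simp add: has_mderiv_def comp_def ad_tens_def linear_0[OF linear_tens_map])
qed

lemma has_mderiv_tens_map_const: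
  fixes F :: "'g \<Rightarrow> 'e tens2"
  assumes "linear T" "has_mderiv G F p D"
  shows "has_mderiv G (\<lambda>g. tens_map T (F g)) p (\<lambda>u. tens_map T (D u))"
  unfolding has_mderiv_def comp_def
proof (rule has_derivative_tens2)
  fix \<phi> \<psi>
  show "((\<lambda>x. tens_map T (F (chart_inv G p x)) \<phi> \<psi>) has_derivative (\<lambda>u. tens_map T (D u) \<phi> \<psi>)) (at (chart G p p))"
    using assms(2) unfolding has_mderiv_def comp_def tens_map_apply[OF assms(1)]
    by (intro bounded_linear.has_derivative[OF blinfun.bounded_linear_left])
qed

text \<open>The function is constant on balls in charts, hence locally constant.\<close>

lemma constant_of_has_mderiv_zero:
  fixes f :: "'g \<Rightarrow> 'b::real_normed_vector"
  assumes "connected (UNIV :: 'g set)" "\<And>g. has_mderiv G f g (\<lambda>u. 0)"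
  shows "f g = f h"
proof -
  have "f constant_on UNIV"
  proof (rule locally_constant_imp_constant[OF assms(1)])
    fix g :: 'g
    obtain R where R: "R > 0" "cball (chart G g g) R \<subseteq> chart_img G g" by (rule chart_contains_cball)
    let ?B = "ball (chart G g g) R"
    have B: "?B \<subseteq> chart_img G g" using R ball_subset_cball by blast
    have "((f \<circ> chart_inv G g) has_derivative (\<lambda>u. 0)) (at x within ?B)" if "x \<in> ?B" for x
    proof -
      have x: "x \<in> chart_img G g" using B that by blast
      have "((f \<circ> chart_inv G g) has_derivative (\<lambda>u. 0)) (at x)"
        using has_mderiv_in_chart[OF assms(2), of "chart_inv G g x" g] x by (simp add: comp_def)
      then show ?thesis by (rule has_derivative_at_withinI)
    qed
    from has_derivative_zero_constant[OF convex_ball this]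
    obtain c where c: "\<And>x. x \<in> ?B \<Longrightarrow> f (chart_inv G g x) = c" by (auto simp: comp_def)
    let ?T = "chart_dom G g \<inter> chart G g -` ?B"
    have "open ?T"
      using chart_homeomorphism[of g]
      by (intro continuous_open_preimage open_chart_dom open_ball) (simp add: homeomorphism_def)
    moreover have "g \<in> ?T" using R by simp
    moreover have "f x = c" if "x \<in> ?T" for x
      using c[of "chart G g x"] that by auto
    ultimately show "\<exists>T. openin (top_of_set UNIV) T \<and> g \<in> T \<and> (\<forall>x\<in>T. f x = f g)"
      by (metis open_openin subtopology_UNIV)
  qed
  then show ?thesis by (auto simp: constant_on_def)
qed

text \<open>The right-trivialised difference \<open>\<eta>\<close> of the two multiplicative bivectors is a cocycle,
  \<open>\<eta>(gh) = \<eta>(g) + Ad g \<eta>(h)\<close>, whose derivative at the identity vanishes because both bivectors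
  have the same cobracket. The cocycle identity propagates this to all points, so \<open>\<eta>\<close> is
  constant, and it vanishes at the identity.\<close>

lemma multiplicative_bivector_eq_coboundary:
  assumes conn: "connected (UNIV :: 'g set)"
    and smooth: "smooth_bivector G \<omega>"
    and mult: "\<And>g h. \<omega> (g \<otimes> h) = tens_map (TL g h) (\<omega> h) + tens_map (TR h g) (\<omega> g)"
    and cob: "\<And>v. cobracket G \<omega> v = ad_tens G v r"
  shows "\<omega> g = coboundary_bivector G r g"
proof -
  let ?c = "coboundary_bivector G r"
  define \<eta> where "\<eta> g = tens_map (TR (inv g) g) (\<omega> g - ?c g)" for g
  have c_mult: "?c (g \<otimes> h) = tens_map (TL g h) (?c h) + tens_map (TR h g) (?c g)" for g h
    by (simp add: coboundary_bivector_eq linear_diff[OF linear_tens_map] tens_map_tens_map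
        linear_TL linear_TR linear_ltrans linear_rtrans comp_def TL_ltrans TR_rtrans TR_ltrans)
  have cocycle: "\<eta> (g \<otimes> h) = tens_map (Ad G g) (\<eta> h) + \<eta> g" for g h
  proof -
    have l: "TR (inv (g \<otimes> h)) (g \<otimes> h) (TL g h u) = Ad G g (TR (inv h) h u)" for u
    proof -
      have "TR (inv (g \<otimes> h)) (g \<otimes> h) (TL g h u) = TR (inv g) g (TR (inv h) (g \<otimes> h) (TL g h u))"
        using TR_TR[of "inv g" "g \<otimes> h" "inv h"] by (simp add: inv_mult m_assoc)
      also have "TR (inv h) (g \<otimes> h) (TL g h u) = TL g \<one> (TR (inv h) h u)"
        using TL_TR[of g h "inv h" u] by simp
      finally show ?thesis by (simp add: Ad_eq ltrans_TL)
    qed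
    have r: "TR (inv (g \<otimes> h)) (g \<otimes> h) (TR h g u) = TR (inv g) g u" for u
      using TR_TR[of "inv (g \<otimes> h)" g h u] by (simp add: inv_mult)
    have "\<omega> (g \<otimes> h) - ?c (g \<otimes> h) = tens_map (TL g h) (\<omega> h - ?c h) + tens_map (TR h g) (\<omega> g - ?c g)"
      by (simp add: mult c_mult linear_diff[OF linear_tens_map])
    then show ?thesis
      by (simp add: \<eta>_def linear_add[OF linear_tens_map] tens_map_tens_map linear_TL linear_TR linear_Ad
          comp_def l r)
  qed
  have "tens_map (Ad G \<one>) t = t" for t
    using tens_map_id[of t] by (simp add: tens_map_def)
  then have "\<eta> \<one> = 0" using cocycle[of \<one> \<one>] by simp
  have \<eta>: "\<eta> g = tens_map (TR (inv g) g) (\<omega> g) - (tens_map (Ad G g) r - r)" for g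
    by (simp add: \<eta>_def coboundary_bivector_eq linear_diff[OF linear_tens_map] tens_map_tens_map
        linear_TR linear_ltrans linear_rtrans comp_def tens_map_id flip: Ad_eq)
  have d1: "has_mderiv G \<eta> \<one> (\<lambda>u. 0)"
  proof -
    obtain D where D: "has_mderiv G (\<lambda>g. tens_map (TR (inv g) g) (\<omega> g)) \<one> D"
      using has_mderiv_right_trivialised_bivector[OF smooth] by blast
    have "D v = ad_tens G v r" for v
      using cob[of v] has_mderiv_imp_mderiv[OF D] by (simp add: cobracket_def push_eq_tens_map)
    then have D': "D = (\<lambda>v. ad_tens G v r)" by (rule ext)
    have "has_mderiv G \<eta> \<one> (\<lambda>v. ad_tens G v r - (ad_tens G v r - 0))"
      using D has_mderiv_tens_map_Ad[of r] unfolding D' has_mderiv_def comp_def \<eta>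
      by (intro has_derivative_diff has_derivative_const)
    then show ?thesis by simp
  qed
  have d: "has_mderiv G \<eta> g (\<lambda>u. 0)" for g
  proof -
    have "has_mderiv G (\<lambda>h. tens_map (Ad G g) (\<eta> h)) \<one> (\<lambda>u. 0)"
      using has_mderiv_tens_map_const[OF linear_Ad d1, of g] by (simp add: linear_0[OF linear_tens_map])
    then have "has_mderiv G ((\<lambda>h. tens_map (Ad G g) (\<eta> h)) \<circ> (\<lambda>h. inv g \<otimes> h)) g ((\<lambda>u. 0) \<circ> TL (inv g) g)"
      by (intro has_mderiv_compose[OF has_tmap_TL]) simp
    then have "has_mderiv G (\<lambda>h. tens_map (Ad G g) (\<eta> (inv g \<otimes> h)) + \<eta> g) g (\<lambda>u. 0 + 0)"
      unfolding has_mderiv_def comp_def by (intro has_derivative_add has_derivative_const)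
    then show ?thesis by (simp flip: cocycle)
  qed
  have "\<eta> g = 0"
    using constant_of_has_mderiv_zero[OF conn d, of g \<one>] \<open>\<eta> \<one> = 0\<close> by simp
  then have "tens_map (rtrans G g) (\<eta> g) = 0" by (simp add: linear_0[OF linear_tens_map])
  moreover have "tens_map (rtrans G g) (\<eta> g) = \<omega> g - ?c g"
    by (simp add: \<eta>_def tens_map_tens_map linear_rtrans linear_TR comp_def tens_map_id)
  ultimately show ?thesis by simp
qed

lemma bivector_eq_skew_part:
  assumes "poisson_lie_group G \<omega>" "quasitriangular G \<omega> r"
    and "\<not> connected (UNIV :: 'g set) \<Longrightarrow> \<forall>g. \<omega> g = coboundary_bivector G r g"
  shows "\<omega> g = tens_map (ltrans G g) (skew_part r) - tens_map (rtrans G g) (skew_part r)"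
proof -
  have smooth: "smooth_bivector G \<omega>"
    using assms(1) by (simp add: poisson_lie_group_def poisson_bivector_def)
  have eq: "\<omega> g = coboundary_bivector G r g" for g
  proof (cases "connected (UNIV :: 'g set)")
    case True
    have mult: "\<omega> (g \<otimes> h) = tens_map (TL g h) (\<omega> h) + tens_map (TR h g) (\<omega> g)" for g h
      using assms(1) by (simp add: poisson_lie_group_def push_eq_tens_map)
    have cob: "cobracket G \<omega> v = ad_tens G v r" for v
      using assms(2) by (simp add: quasitriangular_def)
    show ?thesis
      by (rule multiplicative_bivector_eq_coboundary[OF True smooth mult cob])
  qed (use assms(3) in blast)
  have "\<omega> g \<phi> \<psi> = - \<omega> g \<psi> \<phi>" for \<phi> \<psi>
    using smooth unfolding smooth_bivector_def by blast
  then show ?thesis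
    unfolding eq by (rule skew_coboundary)
qed


section \<open>Bicovariance and invariance\<close>

lemma Ad_transform_eq_iff:
  "\<Xi>h \<phi> \<psi> = Ad_transform G \<Xi>h g \<phi> \<psi> \<longleftrightarrow> Ad_star G g (\<Xi>h \<phi> \<psi>) = \<Xi>h (Ad_star G g \<phi>) (Ad_star G g \<psi>)"
  unfolding Ad_transform_def by (metis Ad_star_inverse)

lemma given_by_ltriv:
  assumes "given_by G \<omega> r \<gamma> \<Xi>h" "smooth_fun G a" "one_form G \<tau>"
  shows "ltriv G (\<gamma> a \<tau>) g = pbracket G \<omega> a (ltriv G \<tau>) g +
    (\<Xi>h (L_hat G a g) (ltriv G \<tau> g) + ad_term (skew_part r) (L_hat G a g) (ltriv G \<tau> g))"
  using assms by (simp add: given_by_def left_invariant_via_def ad_term_def)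

text \<open>Once the correction terms have been moved to the side on which they live, right
  invariance with \<open>\<Psi>\<close> says exactly that \<open>Ad\<^sup>*\<close> carries \<open>\<Xi>h\<close> to \<open>\<Psi>\<close> minus its own
  correction term.\<close>

lemma right_invariance_iff:
  assumes \<omega>: "\<And>g. \<omega> g = tens_map (ltrans G g) (skew_part r) - tens_map (rtrans G g) (skew_part r)"
    and \<gamma>: "given_by G \<omega> r \<gamma> \<Xi>h" and a: "smooth_fun G a" and \<tau>: "one_form G \<tau>"
  shows "Ad_star G g (ltriv G (\<gamma> a \<tau>) g) = pbracket G \<omega> a (rtriv G \<tau>) g + \<Psi> (R_hat G a g) (rtriv G \<tau> g) \<longleftrightarrow>
    Ad_star G g (\<Xi>h (L_hat G a g) (ltriv G \<tau> g)) =
      \<Psi> (Ad_star G g (L_hat G a g)) (Ad_star G g (ltriv G \<tau> g)) -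
      ad_term (skew_part r) (Ad_star G g (L_hat G a g)) (Ad_star G g (ltriv G \<tau> g))"
  by (simp add: given_by_ltriv[OF \<gamma> a \<tau>] pbracket_rtriv[OF \<omega> a \<tau>] R_hat_eq_Ad_star_L_hat[OF a]
      linear_add[OF linear_Ad_star] rtriv_def)

text \<open>For the forward direction, functions and forms with prescribed values at \<open>g\<close> turn right
  invariance into an identity between bilinear maps on the dual. At the identity it
  determines \<open>\<Psi>\<close>.\<close>

lemma bicovariant_iff_Ad_invariant:
  assumes \<omega>: "\<And>g. \<omega> g = tens_map (ltrans G g) (skew_part r) - tens_map (rtrans G g) (skew_part r)"
    and \<gamma>: "given_by G \<omega> r \<gamma> \<Xi>h"
  shows "bicovariant G \<omega> \<gamma> \<longleftrightarrow> (\<forall>g \<phi> \<psi>. \<Xi>h \<phi> \<psi> = Ad_transform G \<Xi>h g \<phi> \<psi>)"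
proof
  assume "bicovariant G \<omega> \<gamma>"
  then obtain \<Psi> where \<Psi>: "right_invariant_via G \<omega> \<gamma> \<Psi>" by (auto simp: bicovariant_def)
  have eq: "Ad_star G g (\<Xi>h \<phi> \<psi>) = \<Psi> (Ad_star G g \<phi>) (Ad_star G g \<psi>) -
      ad_term (skew_part r) (Ad_star G g \<phi>) (Ad_star G g \<psi>)" for g \<phi> \<psi>
  proof -
    obtain a where a: "smooth_fun G a" "L_hat G a g = \<phi>" by (rule exists_smooth_fun_with_L_hat)
    obtain \<tau> where \<tau>: "one_form G \<tau>" "ltriv G \<tau> g = \<psi>" by (rule exists_one_form_with_ltriv)
    show ?thesis
      using right_invariance_iff[OF \<omega> \<gamma> a(1) \<tau>(1), of g \<Psi>] \<Psi> a \<tau> by (simp add: right_invariant_via_def)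
  qed
  have "\<Psi> \<phi> \<psi> - ad_term (skew_part r) \<phi> \<psi> = \<Xi>h \<phi> \<psi>" for \<phi> \<psi>
    using eq[of \<one>] by simp
  then show "\<forall>g \<phi> \<psi>. \<Xi>h \<phi> \<psi> = Ad_transform G \<Xi>h g \<phi> \<psi>"
    by (simp add: Ad_transform_eq_iff eq)
next
  assume inv: "\<forall>g \<phi> \<psi>. \<Xi>h \<phi> \<psi> = Ad_transform G \<Xi>h g \<phi> \<psi>"
  let ?\<Xi> = "\<lambda>\<phi> \<psi>. \<Xi>h \<phi> \<psi> + ad_term (skew_part r) \<phi> \<psi>"
  have left: "left_invariant_via G \<omega> \<gamma> ?\<Xi>"
    using \<gamma> by (simp add: given_by_def ad_term_def)
  then have "bilinear ?\<Xi>" by (simp add: left_invariant_via_def)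
  then have "right_invariant_via G \<omega> \<gamma> ?\<Xi>"
    using inv unfolding right_invariant_via_def Ad_transform_eq_iff
    by (auto simp: right_invariance_iff[OF \<omega> \<gamma>, where \<Psi> = ?\<Xi>])
  then show "bicovariant G \<omega> \<gamma>" using left by (auto simp: bicovariant_def)
qed

lemma as_tensor_map_apply:
  assumes "bilinear \<Xi>h"
  shows "as_tensor_map \<Xi>h v \<phi> \<psi> = \<Xi>h \<phi> \<psi> v"
proof -
  interpret bounded_bilinear \<Xi>h using assms by (rule bilinear_covec_bounded)
  obtain K where K: "K > 0" "\<And>\<phi> \<psi>. norm (\<Xi>h \<phi> \<psi>) \<le> norm \<phi> * norm \<psi> * K" using pos_bounded by blast
  have b: "bounded_linear (\<lambda>\<psi>. \<Xi>h \<phi> \<psi> v)" for \<phi>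
    by (rule bounded_linear_compose[OF blinfun.bounded_linear_left bounded_linear_right])
  define T where "T \<phi> = Blinfun (\<lambda>\<psi>. \<Xi>h \<phi> \<psi> v)" for \<phi>
  have T: "T \<phi> \<psi> = \<Xi>h \<phi> \<psi> v" for \<phi> \<psi>
    by (simp add: T_def bounded_linear_Blinfun_apply[OF b])
  have "bounded_linear T"
  proof (rule bounded_linear_intro)
    show "norm (T \<phi>) \<le> norm \<phi> * (K * norm v)" for \<phi>
    proof (rule norm_blinfun_bound)
      show "norm (T \<phi> \<psi>) \<le> norm \<phi> * (K * norm v) * norm \<psi>" for \<psi>
        using order_trans[OF norm_blinfun mult_right_mono[OF K(2)], of v \<phi> \<psi>]
        by (simp add: T mult_ac)
    qed (use K in simp)
  qed (auto intro!: blinfun_eqI simp: T blinfun.add_left blinfun.scaleR_left add_left scaleR_left)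
  then show ?thesis by (simp add: as_tensor_map_def bounded_linear_Blinfun_apply T flip: T_def)
qed

text \<open>Evaluated at \<open>v\<close>, the transform is \<open>\<Xi>h(Ad\<^sup>* \<phi>, Ad\<^sup>* \<psi>)(Ad g v)\<close>, to which the product rule applies
  in all three arguments.\<close>

lemma has_mderiv_Ad_transform:
  assumes "bilinear \<Xi>h"
  shows "has_mderiv G (\<lambda>g. Ad_transform G \<Xi>h g \<phi> \<psi>) \<one> (\<lambda>w.
    \<Xi>h (ad_star G w \<phi>) \<psi> + \<Xi>h \<phi> (ad_star G w \<psi>) - ad_star G w (\<Xi>h \<phi> \<psi>))"
proof (rule has_mderiv_covec)
  fix v
  have B: "bounded_bilinear \<Xi>h" using assms by (rule bilinear_covec_bounded)
  have s: "has_mderiv G (\<lambda>h. Ad_star G h \<phi>) \<one> (\<lambda>w. ad_star G w \<phi>)" for \<phi>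
    by (rule has_mderiv_covec)
       (simp add: Ad_star_apply ad_star_apply has_mderiv_covec_const[OF has_mderiv_Ad_inv])
  note bounded_bilinear.FDERIV[OF B s[unfolded has_mderiv_def] s[unfolded has_mderiv_def], of \<phi> \<psi>]
  from bounded_bilinear.FDERIV[OF bounded_bilinear_blinfun_apply this has_mderiv_Ad[of v, unfolded has_mderiv_def]]
  have "has_mderiv G (\<lambda>g. \<Xi>h (Ad_star G g \<phi>) (Ad_star G g \<psi>) (Ad G g v)) \<one>
      (\<lambda>w. \<Xi>h \<phi> \<psi> (lie_bracket G w v) + (\<Xi>h \<phi> (ad_star G w \<psi>) + \<Xi>h (ad_star G w \<phi>) \<psi>) v)"
    by (simp add: has_mderiv_def comp_def)
  moreover have "(\<Xi>h (ad_star G w \<phi>) \<psi> + \<Xi>h \<phi> (ad_star G w \<psi>) - ad_star G w (\<Xi>h \<phi> \<psi>)) v =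
      \<Xi>h \<phi> \<psi> (lie_bracket G w v) + (\<Xi>h \<phi> (ad_star G w \<psi>) + \<Xi>h (ad_star G w \<phi>) \<psi>) v" for w
    using lie_bracket_antisym[of v w]
    by (simp add: blinfun.add_left blinfun.diff_left ad_star_apply blinfun.minus_right)
  ultimately show "has_mderiv G (\<lambda>g. Ad_transform G \<Xi>h g \<phi> \<psi> v) \<one>
      (\<lambda>w. (\<Xi>h (ad_star G w \<phi>) \<psi> + \<Xi>h \<phi> (ad_star G w \<psi>) - ad_star G w (\<Xi>h \<phi> \<psi>)) v)"
    by (simp only: Ad_transform_def Ad_star_apply) simp
qed

lemma infinitesimal_invariance_iff:
  assumes "bilinear \<Xi>h"
  shows "(\<forall>w \<phi> \<psi>. mderiv G (\<lambda>g. Ad_transform G \<Xi>h g \<phi> \<psi>) \<one> w = 0) \<longleftrightarrow>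
     (\<forall>v w. as_tensor_map \<Xi>h (lie_bracket G v w) =
        contract (\<lambda>x y. tensor (lie_bracket G x w) y + tensor x (lie_bracket G y w))
          (as_tensor_map \<Xi>h v))"
proof -
  have lhs: "mderiv G (\<lambda>g. Ad_transform G \<Xi>h g \<phi> \<psi>) \<one> w = 0 \<longleftrightarrow>
      (\<forall>v. \<Xi>h \<phi> \<psi> (lie_bracket G v w) = \<Xi>h (ad_star G w \<phi>) \<psi> v + \<Xi>h \<phi> (ad_star G w \<psi>) v)" for w \<phi> \<psi>
  proof -
    have zero_iff: "f = 0 \<longleftrightarrow> (\<forall>v. f v = 0)" for f :: "'e covec"
      by (auto intro: blinfun_eqI)
    show ?thesis
      unfolding has_mderiv_imp_mderiv[OF has_mderiv_Ad_transform[OF assms]] zero_iff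
      by (auto simp: blinfun.add_left blinfun.diff_left ad_star_apply)
  qed
  have rhs: "contract (\<lambda>x y. tensor (lie_bracket G x w) y + tensor x (lie_bracket G y w)) t \<phi> \<psi> =
      t (ad_star G w \<phi>) \<psi> + t \<phi> (ad_star G w \<psi>)" for w t \<phi> \<psi>
    using contract_eval[of "ad_star G w \<phi>" \<psi> t] contract_eval[of \<phi> "ad_star G w \<psi>" t]
    by (simp add: blinfun_apply_contract blinfun.add_left contract_plus tensor_apply ad_star_apply)
  have tens_iff: "s = t \<longleftrightarrow> (\<forall>\<phi> \<psi>. s \<phi> \<psi> = t \<phi> \<psi>)" for s t :: "'e tens2"
    by (auto intro: tens2_eqI)
  show ?thesis
    unfolding lhs tens_iff rhs as_tensor_map_apply[OF assms] by blast
qed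

end

theorem proposition4p15:
  fixes G :: "('g::{t2_space,second_countable_topology}, 'e::euclidean_space) lie_struct"
    and \<omega> :: "'g \<Rightarrow> 'e tens2"
    and r :: "'e tens2"
    and \<gamma> :: "('g \<Rightarrow> real) \<Rightarrow> ('g \<Rightarrow> 'e covec) \<Rightarrow> ('g \<Rightarrow> 'e covec)"
    and \<Xi>h :: "'e covec \<Rightarrow> 'e covec \<Rightarrow> 'e covec"
  assumes "poisson_lie_group G \<omega>"
    and "quasitriangular G \<omega> r"
    and "\<not> connected (UNIV :: 'g set) \<Longrightarrow> \<forall>g. \<omega> g = coboundary_bivector G r g"
    and "preconnection G \<omega> \<gamma>"
    and "given_by G \<omega> r \<gamma> \<Xi>h"
  shows "(bicovariant G \<omega> \<gamma> \<longleftrightarrow> (\<forall>g \<phi> \<psi>. \<Xi>h \<phi> \<psi> = Ad_transform G \<Xi>h g \<phi> \<psi>)) \<and>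
    ((\<forall>w \<phi> \<psi>. mderiv G (\<lambda>g. Ad_transform G \<Xi>h g \<phi> \<psi>) \<one>\<^bsub>G\<^esub> w = 0) \<longleftrightarrow>
     (\<forall>v w. as_tensor_map \<Xi>h (lie_bracket G v w) =
        contract (\<lambda>x y. tensor (lie_bracket G x w) y + tensor x (lie_bracket G y w))
          (as_tensor_map \<Xi>h v)))"
proof -
  interpret lie G
    using assms(1) by unfold_locales (simp add: poisson_lie_group_def)
  show ?thesis
    using bicovariant_iff_Ad_invariant[OF bivector_eq_skew_part[OF assms(1-3)] assms(5)]
      infinitesimal_invariance_iff[of \<Xi>h] assms(5)
    by (simp add: given_by_def)
qed

end
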